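(* Let $K=\{\kappa_\xi\mid\xi<\theta\}$ (increasingly enumerated) be a set of regular uncountable cardinals such that $\theta^+<\kappa_0$, $\kappa_0$ is not the successor of a singular cardinal, and GCH holds from some cardinal $\psi$ with $\psi^{++}<\kappa_0$ on. Let $\kappa^*=\sup K$, assume $\mathcal C=\langle C_\alpha\mid\alpha\in\mathbf{Sing}_{\kappa^*+1}\rangle$ is a $\square_{(\kappa^*+1)}$-sequence, and let $\langle S_\kappa\mid\kappa\in K\rangle$ be such that each $S_\kappa\subseteq E^\kappa_\omega$ is stationary in $\kappa$. Then there is a sequence $\langle\bar S_\kappa\mid\kappa\in K\rangle$ such that each $\bar S_\kappa\subseteq S_\kappa$ is stationary in $\kappa$ and the sequence $\langle T_\kappa=\kappa\setminus\bar S_\kappa\mid\kappa\in K\rangle$ is strongly mutually fat.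
   Context: $E^\kappa_\omega=\{\beta<\kappa:\mathrm{cf}(\beta)=\omega\}$. $\mathbf{Sing}_{\gamma}$ is the set of singular limit ordinals below $\gamma$. A $\square_{(\gamma)}$-sequence is a sequence $\langle C_\alpha\mid\alpha\in\mathbf{Sing}_\gamma\rangle$ such that each $C_\alpha$ is club in $\alpha$, $\mathrm{otp}(C_\alpha)<\alpha$, and if $\beta$ is a limit point of $C_\alpha$ then $C_\beta=C_\alpha\cap\beta$. Mutual fatness: for a set $K$ of regular cardinals and sets $T_\kappa\subseteq\kappa$, the collection is mutually $\nu$-fat ($\nu<\min K$) if for every algebra $\mathfrak A$ (countably many finitary functions/relations) on $H(\chi)$ for large enough $\chi$ there is an increasing continuous sequence $\langle N_\alpha\mid\alpha\le\nu\rangle$ of elementary substructures of $\mathfrak A$ with $\sup(N_\alpha\cap\kappa)\in T_\kappa$ for all $\alpha\le\nu$ and $\kappa\in N_\alpha\cap K$, this supremum lying in $N_{\alpha+1}$ when $\alpha<\nu$; mutually fat = mutually $\nu$-fat for all regular $\nu<\min K$; strongly mutually fat = for every such algebra the witnessing models can be taken to contain $K$ as a subset. *)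

theory Defs
  imports Main "HOL-Library.Equipollence"
begin

section \<open>A universe of sets\<close>

text \<open>
  The ambient universe is an arbitrary type satisfying the axioms of ZFC, with Separation and
  Replacement for arbitrary HOL predicates and functions; Choice is inherited from HOL.
  Consequently a subset of some \<open>elts x\<close>, or a function on such a set, given at the level of
  HOL is the same thing as one inside the universe, and such objects are written as HOL sets
  and functions below.
\<close>

class zfc =
  fixes elts :: "'a \<Rightarrow> 'a set"
  assumes zfc_extensionality: "elts x = elts y \<Longrightarrow> x = y"
    and zfc_foundation: "wf {(x, y). x \<in> elts y}"
    and zfc_separation: "Y \<subseteq> elts x \<Longrightarrow> \<exists>y. elts y = Y"
    and zfc_union: "\<exists>u. elts u = \<Union> (elts ` elts x)"
    and zfc_power: "\<exists>p. elts p = {y. elts y \<subseteq> elts x}"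
    and zfc_replacement: "\<exists>y. elts y = f ` elts x"
    and zfc_infinity: "\<exists>y. elts y = range (g :: nat \<Rightarrow> 'a)"


section \<open>Ordinals and cardinals\<close>

text \<open>Ordinals are von Neumann ordinals: \<open>\<alpha> < \<beta>\<close> is \<open>\<alpha> \<in> elts \<beta>\<close>, and \<open>\<alpha> \<le> \<beta>\<close> is
  \<open>elts \<alpha> \<subseteq> elts \<beta>\<close>.\<close>

definition transitive_set :: "'v::zfc \<Rightarrow> bool" where
  "transitive_set x \<longleftrightarrow> (\<forall>y\<in>elts x. elts y \<subseteq> elts x)"

definition Ord :: "'v::zfc \<Rightarrow> bool" where
  "Ord x \<longleftrightarrow> transitive_set x \<and> (\<forall>y\<in>elts x. transitive_set y)"

definition ozero :: "'v::zfc" where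
  "ozero = (THE x. elts x = {})"

definition osucc :: "'v::zfc \<Rightarrow> 'v" where
  "osucc a = (THE x. elts x = insert a (elts a))"

definition least_ord :: "('v::zfc \<Rightarrow> bool) \<Rightarrow> 'v" where
  "least_ord P = (THE a. Ord a \<and> P a \<and> (\<forall>b\<in>elts a. \<not> P b))"

definition osup :: "'v::zfc set \<Rightarrow> 'v" where
  "osup X = least_ord (\<lambda>b. \<forall>x\<in>X. elts x \<subseteq> elts b)"

definition Limit :: "'v::zfc \<Rightarrow> bool" where
  "Limit a \<longleftrightarrow> Ord a \<and> elts a \<noteq> {} \<and> (\<forall>b\<in>elts a. osucc b \<in> elts a)"

definition omega :: "'v::zfc" where
  "omega = least_ord Limit"

definition otp :: "'v::zfc set \<Rightarrow> 'v" where
  "otp X = (THE b. Ord b \<and> (\<exists>f. bij_betw f (elts b) X \<and>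
     (\<forall>x\<in>elts b. \<forall>y\<in>elts b. x \<in> elts y \<longrightarrow> f x \<in> elts (f y))))"

definition cf :: "'v::zfc \<Rightarrow> 'v" where
  "cf a = least_ord (\<lambda>b. \<exists>f. f ` elts b \<subseteq> elts a \<and>
     (\<forall>x\<in>elts a. \<exists>y\<in>elts b. elts x \<subseteq> elts (f y)))"

definition Card :: "'v::zfc \<Rightarrow> bool" where
  "Card k \<longleftrightarrow> Ord k \<and> (\<forall>a\<in>elts k. elts a \<prec> elts k)"

definition InfCard :: "'v::zfc \<Rightarrow> bool" where
  "InfCard k \<longleftrightarrow> Card k \<and> infinite (elts k)"

definition csucc :: "'v::zfc \<Rightarrow> 'v" where
  "csucc a = least_ord (\<lambda>k. Card k \<and> a \<in> elts k)"

definition regular_card :: "'v::zfc \<Rightarrow> bool" where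
  "regular_card k \<longleftrightarrow> InfCard k \<and> cf k = k"

definition singular_card :: "'v::zfc \<Rightarrow> bool" where
  "singular_card k \<longleftrightarrow> InfCard k \<and> cf k \<in> elts k"

definition GCH_from :: "'v::zfc \<Rightarrow> bool" where
  "GCH_from p \<longleftrightarrow>
     (\<forall>l. InfCard l \<and> elts p \<subseteq> elts l \<longrightarrow> Pow (elts l) \<approx> elts (csucc l))"


section \<open>Clubs, stationary sets and squares\<close>

definition E_omega :: "'v::zfc \<Rightarrow> 'v set" where
  "E_omega k = {b \<in> elts k. cf b = omega}"

definition limit_point :: "'v::zfc \<Rightarrow> 'v set \<Rightarrow> bool" where
  "limit_point b C \<longleftrightarrow> Limit b \<and> (\<forall>x\<in>elts b. \<exists>y\<in>C \<inter> elts b. x \<in> elts y)"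

definition club :: "'v::zfc set \<Rightarrow> 'v \<Rightarrow> bool" where
  "club C a \<longleftrightarrow> C \<subseteq> elts a \<and> (\<forall>x\<in>elts a. \<exists>y\<in>C. x \<in> elts y) \<and>
     (\<forall>b\<in>elts a. limit_point b C \<longrightarrow> b \<in> C)"

definition stationary :: "'v::zfc set \<Rightarrow> 'v \<Rightarrow> bool" where
  "stationary S a \<longleftrightarrow> S \<subseteq> elts a \<and> (\<forall>C. club C a \<longrightarrow> S \<inter> C \<noteq> {})"

definition Sing :: "'v::zfc \<Rightarrow> 'v set" where
  "Sing g = {a \<in> elts g. Limit a \<and> cf a \<in> elts a}"

text \<open>The sequence is indexed by \<^term>\<open>Sing g\<close> only, so the coherence clause
  \<open>C\<^sub>\<beta> = C\<^sub>\<alpha> \<inter> \<beta>\<close> includes that \<open>\<beta>\<close> is an index.\<close>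

definition square_seq :: "'v::zfc \<Rightarrow> ('v \<Rightarrow> 'v set) \<Rightarrow> bool" where
  "square_seq g C \<longleftrightarrow> (\<forall>a\<in>Sing g.
     club (C a) a \<and> otp (C a) \<in> elts a \<and>
     (\<forall>b\<in>elts a. limit_point b (C a) \<longrightarrow> b \<in> Sing g \<and> C b = C a \<inter> elts b))"


section \<open>Algebras and elementary substructures\<close>

definition H :: "'v::zfc \<Rightarrow> 'v set" where
  "H c = {x. {y. (y, x) \<in> {(u, w). u \<in> elts w}\<^sup>+} \<prec> elts c}"

text \<open>Finite families of functions or relations are covered by repeating members or by adding
  projections and trivial relations. The values of \<open>fun_of\<close> and \<open>rel_of\<close> on lists of the wrong
  length, or with entries outside the carrier, are irrelevant.\<close>

record 'a alg =
  fun_arity :: "nat \<Rightarrow> nat"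
  rel_arity :: "nat \<Rightarrow> nat"
  fun_of :: "nat \<Rightarrow> 'a list \<Rightarrow> 'a"
  rel_of :: "nat \<Rightarrow> 'a list \<Rightarrow> bool"

definition algebra_on :: "'a set \<Rightarrow> 'a alg \<Rightarrow> bool" where
  "algebra_on A M \<longleftrightarrow>
     (\<forall>i xs. length xs = fun_arity M i \<and> set xs \<subseteq> A \<longrightarrow> fun_of M i xs \<in> A)"

datatype tm = Var nat | Fun nat "tm list"

datatype fm = Eq tm tm | Rel nat "tm list" | Neg fm | Conj fm fm | Ex nat fm

fun wf_tm :: "'a alg \<Rightarrow> tm \<Rightarrow> bool" where
  "wf_tm M (Var n) \<longleftrightarrow> True"
| "wf_tm M (Fun i ts) \<longleftrightarrow> length ts = fun_arity M i \<and> (\<forall>t\<in>set ts. wf_tm M t)"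

fun wf_fm :: "'a alg \<Rightarrow> fm \<Rightarrow> bool" where
  "wf_fm M (Eq s t) \<longleftrightarrow> wf_tm M s \<and> wf_tm M t"
| "wf_fm M (Rel i ts) \<longleftrightarrow> length ts = rel_arity M i \<and> (\<forall>t\<in>set ts. wf_tm M t)"
| "wf_fm M (Neg p) \<longleftrightarrow> wf_fm M p"
| "wf_fm M (Conj p q) \<longleftrightarrow> wf_fm M p \<and> wf_fm M q"
| "wf_fm M (Ex n p) \<longleftrightarrow> wf_fm M p"

fun tm_val :: "'a alg \<Rightarrow> (nat \<Rightarrow> 'a) \<Rightarrow> tm \<Rightarrow> 'a" where
  "tm_val M e (Var n) = e n"
| "tm_val M e (Fun i ts) = fun_of M i (map (tm_val M e) ts)"

fun sat :: "'a set \<Rightarrow> 'a alg \<Rightarrow> (nat \<Rightarrow> 'a) \<Rightarrow> fm \<Rightarrow> bool" where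
  "sat A M e (Eq s t) \<longleftrightarrow> tm_val M e s = tm_val M e t"
| "sat A M e (Rel i ts) \<longleftrightarrow> rel_of M i (map (tm_val M e) ts)"
| "sat A M e (Neg p) \<longleftrightarrow> \<not> sat A M e p"
| "sat A M e (Conj p q) \<longleftrightarrow> sat A M e p \<and> sat A M e q"
| "sat A M e (Ex n p) \<longleftrightarrow> (\<exists>a\<in>A. sat A M (e(n := a)) p)"

definition elementary_sub :: "'a set \<Rightarrow> 'a set \<Rightarrow> 'a alg \<Rightarrow> bool" where
  "elementary_sub N A M \<longleftrightarrow> N \<noteq> {} \<and> N \<subseteq> A \<and> algebra_on N M \<and>
     (\<forall>p e. wf_fm M p \<and> range e \<subseteq> N \<longrightarrow> sat N M e p = sat A M e p)"


section \<open>Mutual fatness\<close>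

definition fat_chain ::
  "'v::zfc set \<Rightarrow> 'v alg \<Rightarrow> 'v set \<Rightarrow> ('v \<Rightarrow> 'v set) \<Rightarrow> 'v \<Rightarrow> ('v \<Rightarrow> 'v set) \<Rightarrow> bool" where
  "fat_chain A M K T n N \<longleftrightarrow>
     (\<forall>a\<in>elts (osucc n). elementary_sub (N a) A M) \<and>
     (\<forall>b\<in>elts (osucc n). \<forall>a\<in>elts b. N a \<subseteq> N b) \<and>
     (\<forall>d\<in>elts (osucc n). Limit d \<longrightarrow> N d = (\<Union>a\<in>elts d. N a)) \<and>
     (\<forall>a\<in>elts (osucc n). \<forall>k\<in>N a \<inter> K.
        osup (N a \<inter> elts k) \<in> T k \<and>
        (a \<in> elts n \<longrightarrow> osup (N a \<inter> elts k) \<in> N (osucc a)))"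

definition mutually_nu_fat :: "'v::zfc \<Rightarrow> 'v set \<Rightarrow> ('v \<Rightarrow> 'v set) \<Rightarrow> bool" where
  "mutually_nu_fat n K T \<longleftrightarrow>
     (\<exists>c0. Card c0 \<and> (\<forall>c. Card c \<and> elts c0 \<subseteq> elts c \<longrightarrow>
        (\<forall>M. algebra_on (H c) M \<longrightarrow> (\<exists>N. fat_chain (H c) M K T n N))))"

definition mutually_fat :: "'v::zfc set \<Rightarrow> ('v \<Rightarrow> 'v set) \<Rightarrow> bool" where
  "mutually_fat K T \<longleftrightarrow>
     (\<forall>n. regular_card n \<and> (\<forall>k\<in>K. n \<in> elts k) \<longrightarrow> mutually_nu_fat n K T)"

definition strongly_mutually_nu_fat :: "'v::zfc \<Rightarrow> 'v set \<Rightarrow> ('v \<Rightarrow> 'v set) \<Rightarrow> bool" where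
  "strongly_mutually_nu_fat n K T \<longleftrightarrow>
     (\<exists>c0. Card c0 \<and> (\<forall>c. Card c \<and> elts c0 \<subseteq> elts c \<longrightarrow>
        (\<forall>M. algebra_on (H c) M \<longrightarrow>
           (\<exists>N. fat_chain (H c) M K T n N \<and> (\<forall>a\<in>elts (osucc n). K \<subseteq> N a)))))"

definition strongly_mutually_fat :: "'v::zfc set \<Rightarrow> ('v \<Rightarrow> 'v set) \<Rightarrow> bool" where
  "strongly_mutually_fat K T \<longleftrightarrow>
     (\<forall>n. regular_card n \<and> (\<forall>k\<in>K. n \<in> elts k) \<longrightarrow> strongly_mutually_nu_fat n K T)"

end

theory Submission
  imports Defs "HOL-Library.Countable"
begin

text \<open>Every \<open>\<beta> \<in> S\<^sub>\<kappa>\<close> above \<open>\<omega>\<close> is singular, so \<open>\<beta> \<mapsto> otp (C\<^sub>\<beta>)\<close> is regressive there and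
  Fodor's lemma gives a stationary \<open>S'\<^sub>\<kappa> \<subseteq> S\<^sub>\<kappa>\<close> on which \<open>otp (C\<^sub>\<beta>)\<close> is constant. Given a
  regular \<open>\<nu> < min K\<close>, choose a regular uncountable \<open>\<mu> < min K\<close> with \<open>\<nu> \<le> \<mu>\<close> and \<open>\<theta> < \<mu>\<close>, and
  a continuous chain of Skolem hulls \<open>N\<^sub>\<alpha>\<close>, \<open>\<alpha> \<le> \<mu>\<close>, of size at most \<open>\<mu>\<close>, each containing the
  suprema of the earlier ones. The supremum \<open>\<gamma>\<close> of \<open>N\<^sub>\<mu> \<inter> \<kappa>\<close> has cofinality \<open>\<mu>\<close>, so it is
  singular and not in \<open>S'\<^sub>\<kappa>\<close>; for club many \<open>\<alpha> < \<mu>\<close> the supremum of \<open>N\<^sub>\<alpha> \<inter> \<kappa>\<close> is a limit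
  point of \<open>C\<^sub>\<gamma>\<close>, and at most one limit point of \<open>C\<^sub>\<gamma>\<close> lies in \<open>S'\<^sub>\<kappa>\<close> because coherence makes
  the order types there distinct. As \<open>|K| < \<mu>\<close>, one club of \<open>\<alpha>\<close> serves all \<open>\<kappa> \<in> K\<close>, and its
  first \<open>\<nu> + 1\<close> elements (with \<open>\<mu>\<close> itself on top if \<open>\<nu> = \<mu>\<close>) index the required chain.\<close>

section \<open>Ordinals\<close>

lemma mem_irrefl: "(x :: 'v::zfc) \<notin> elts x"
  using wf_not_refl[OF zfc_foundation] by auto

lemma mem_not_sym: "x \<in> elts y \<Longrightarrow> (y :: 'v::zfc) \<notin> elts x"
  using wf_not_sym[OF zfc_foundation] by auto

lemma mem_induct [case_names step]:
  fixes x :: "'v::zfc"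
  assumes "\<And>x. (\<And>y. y \<in> elts x \<Longrightarrow> P y) \<Longrightarrow> P x"
  shows "P x"
  by (rule wf_induct_rule[OF zfc_foundation]) (use assms in auto)

lemma Ord_trans: "\<lbrakk>Ord c; b \<in> elts c; a \<in> elts b\<rbrakk> \<Longrightarrow> a \<in> elts c"
  unfolding Ord_def transitive_set_def by blast

lemma Ord_in: "\<lbrakk>Ord a; x \<in> elts a\<rbrakk> \<Longrightarrow> Ord x"
  unfolding Ord_def transitive_set_def by blast

lemma Ord_subset: "\<lbrakk>Ord a; x \<in> elts a\<rbrakk> \<Longrightarrow> elts x \<subseteq> elts a"
  using Ord_trans by blast

lemma OrdI: "\<lbrakk>\<And>x y. \<lbrakk>x \<in> elts a; y \<in> elts x\<rbrakk> \<Longrightarrow> y \<in> elts a; \<And>x. x \<in> elts a \<Longrightarrow> Ord x\<rbrakk> \<Longrightarrow> Ord a"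
  unfolding Ord_def transitive_set_def by blast

lemma Ord_linear:
  fixes a b :: "'v::zfc"
  assumes "Ord a" "Ord b"
  shows "a \<in> elts b \<or> a = b \<or> b \<in> elts a"
  using assms
proof (induction a arbitrary: b rule: mem_induct)
  case (step a)
  note IHa = step.IH and a = step.prems(1)
  from step.prems(2) show ?case
  proof (induction b rule: mem_induct)
    case (step b)
    show ?case
    proof (rule ccontr)
      assume neg: "\<not> ?thesis"
      have "x \<in> elts b" if "x \<in> elts a" for x
        using IHa[OF that Ord_in[OF a that] step.prems] neg that Ord_trans[OF a that] by blast
      moreover have "y \<in> elts a" if "y \<in> elts b" for y
        using step.IH[OF that Ord_in[OF step.prems that]] neg that
          Ord_trans[OF step.prems that] by blast
      ultimately have "elts a = elts b" by blast
      then show False using neg zfc_extensionality by blast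
    qed
  qed
qed

lemma Ord_subset_cases:
  "\<lbrakk>Ord a; Ord b; elts a \<subseteq> elts b\<rbrakk> \<Longrightarrow> a \<in> elts b \<or> a = b"
  using Ord_linear[of a b] mem_irrefl[of b] by blast

lemma Ord_not_mem: "\<lbrakk>Ord a; Ord b; a \<notin> elts b\<rbrakk> \<Longrightarrow> elts b \<subseteq> elts a"
  using Ord_linear[of a b] Ord_subset[of a b] by blast

lemma Ord_mem_subset_trans:
  "\<lbrakk>Ord a; Ord b; elts a \<subseteq> elts b; b \<in> elts c; Ord c\<rbrakk> \<Longrightarrow> a \<in> elts c"
  using Ord_subset_cases[of a b] Ord_trans[of c b a] by blast

text \<open>The \<open>THE\<close> in \<open>least_ord\<close> denotes as soon as some witness
  exists: foundation gives a minimal witness, and linearity of the ordinals makes it unique.\<close>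

lemma least_ord:
  fixes a :: "'v::zfc"
  assumes "Ord a" "P a"
  shows "Ord (least_ord P)" and "P (least_ord P)"
    and "\<And>b. b \<in> elts (least_ord P) \<Longrightarrow> \<not> P b"
    and "\<And>b. \<lbrakk>Ord b; P b\<rbrakk> \<Longrightarrow> elts (least_ord P) \<subseteq> elts b"
proof -
  have "\<exists>m. Ord m \<and> P m \<and> (\<forall>y\<in>elts m. Ord y \<longrightarrow> \<not> P y)"
    using assms by (induction a rule: mem_induct) metis
  then obtain m where m: "Ord m" "P m" "\<And>y. \<lbrakk>y \<in> elts m; Ord y\<rbrakk> \<Longrightarrow> \<not> P y" by auto
  have n: "\<not> P b" if "b \<in> elts m" for b using m(3)[OF that Ord_in[OF m(1) that]] .
  have u: "x = m" if "Ord x \<and> P x \<and> (\<forall>b\<in>elts x. \<not> P b)" for x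
    using Ord_linear[of x m] that m(1,2) n by blast
  have eq: "least_ord P = m"
    unfolding least_ord_def
    by (rule the_equality, use m(1,2) n in blast, rule u)
  show "Ord (least_ord P)" "P (least_ord P)" using m(1,2) eq by auto
  show "\<not> P b" if "b \<in> elts (least_ord P)" for b using n that eq by simp
  show "elts (least_ord P) \<subseteq> elts b" if "Ord b" "P b" for b
    using Ord_not_mem[OF that(1) m(1)] n[of b] that(2) eq by auto
qed

lemma elts_ozero [simp]: "elts (ozero :: 'v::zfc) = {}"
proof -
  obtain y :: 'v where "elts y = {}" using zfc_separation[of "{}"] by auto
  moreover from this have "ozero = y"
    unfolding ozero_def by (intro the_equality) (simp_all add: zfc_extensionality)
  ultimately show ?thesis by simp
qed

lemma elts_osucc:
  assumes "Ord a" shows "elts (osucc a) = insert a (elts a)"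
proof -
  obtain p where "elts p = {y. elts y \<subseteq> elts a}" using zfc_power by blast
  then have "insert a (elts a) \<subseteq> elts p" using assms Ord_subset by auto
  then obtain s where s: "elts s = insert a (elts a)" using zfc_separation by blast
  then have "osucc a = s"
    unfolding osucc_def by (intro the_equality) (simp_all add: zfc_extensionality)
  with s show ?thesis by simp
qed

lemma Ord_osucc: "Ord a \<Longrightarrow> Ord (osucc a)"
  by (rule OrdI) (auto simp: elts_osucc intro: Ord_trans Ord_in)

lemma Limit_Ord: "Limit a \<Longrightarrow> Ord a"
  by (simp add: Limit_def)

lemma Limit_above:
  assumes "Limit a" "x \<in> elts a" shows "\<exists>y\<in>elts a. x \<in> elts y"
  using assms elts_osucc Ord_in unfolding Limit_def by blast

lemma LimitI:
  assumes "Ord a" "elts a \<noteq> {}" "\<And>x. x \<in> elts a \<Longrightarrow> \<exists>y\<in>elts a. x \<in> elts y"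
  shows "Limit a"
  unfolding Limit_def
proof (intro conjI ballI assms)
  fix x assume x: "x \<in> elts a"
  then obtain y where y: "y \<in> elts a" "x \<in> elts y" using assms by blast
  have o: "Ord x" "Ord y" using x y Ord_in assms(1) by blast+
  then have "elts (osucc x) \<subseteq> elts y" using y(2) Ord_trans by (auto simp: elts_osucc)
  then show "osucc x \<in> elts a"
    using Ord_mem_subset_trans o y(1) Ord_osucc assms(1) by blast
qed

text \<open>Every finite subset of a limit ordinal has a strict upper bound inside it; if the whole
  ordinal were finite, such a bound would be a member of itself.\<close>

lemma infinite_Limit:
  assumes "Limit a" shows "infinite (elts a)"
proof
  assume fin: "finite (elts a)"
  have "\<exists>y\<in>elts a. \<forall>x\<in>F. x \<in> elts y" if "finite F" "F \<subseteq> elts a" for F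
    using that
  proof (induction F)
    case empty
    then show ?case using assms unfolding Limit_def by blast
  next
    case (insert x F)
    then obtain y where y: "y \<in> elts a" "\<forall>x\<in>F. x \<in> elts y" by blast
    obtain z where z: "z \<in> elts a" "x \<in> elts z" using insert.prems Limit_above[OF assms] by blast
    have o: "Ord y" "Ord z" using y z Ord_in[OF Limit_Ord[OF assms]] by auto
    consider "elts y \<subseteq> elts z" | "elts z \<subseteq> elts y"
      using Ord_not_mem[OF o(2,1)] Ord_subset[OF o(1)] by metis
    then show ?case using y z by (cases; blast)
  qed
  from this[OF fin order_refl] show False using mem_irrefl by blast
qed

lemma Union_Ord:
  fixes X :: "'v::zfc set"
  assumes "X \<subseteq> elts x" "\<And>y. y \<in> X \<Longrightarrow> Ord y"
  shows "\<exists>u. Ord u \<and> elts u = \<Union> (elts ` X)"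
proof -
  obtain x' where x': "elts x' = X" using zfc_separation assms(1) by blast
  obtain u where u: "elts u = \<Union> (elts ` X)" using zfc_union[of x'] x' by auto
  moreover have "Ord u"
  proof (rule OrdI)
    show "y \<in> elts u" if "x \<in> elts u" "y \<in> elts x" for x y
      using that u Ord_trans[OF assms(2)] by blast
    show "Ord x" if "x \<in> elts u" for x using that u Ord_in[OF assms(2)] by blast
  qed
  ultimately show ?thesis by blast
qed

text \<open>The union is the least upper bound. It is not a strict bound: a largest element of
  \<open>X\<close> equals \<open>osup X\<close> instead of lying below it.\<close>

lemma osup:
  fixes X :: "'v::zfc set"
  assumes "X \<subseteq> elts x" "\<And>y. y \<in> X \<Longrightarrow> Ord y"
  shows "Ord (osup X)" and "elts (osup X) = \<Union> (elts ` X)"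
proof -
  let ?P = "\<lambda>b. \<forall>x\<in>X. elts x \<subseteq> elts b"
  obtain u where u: "Ord u" "elts u = \<Union> (elts ` X)" using Union_Ord[OF assms] by blast
  then have P: "?P u" by auto
  note l = least_ord[where P = ?P, OF u(1) P, folded osup_def]
  show "elts (osup X) = \<Union> (elts ` X)" using l(2) l(4)[OF u(1) P] u(2) by blast
  show "Ord (osup X)" by (rule l(1))
qed

section \<open>Collapsing well-founded relations\<close>

text \<open>Turns a HOL set into an element of the universe. It is meaningful for small sets, in
  particular for those covered by an image of some \<open>elts x\<close>.\<close>

definition set_of :: "'v::zfc set \<Rightarrow> 'v" where
  "set_of X = (THE x. elts x = X)"

lemma elts_set_of:
  fixes f :: "'v::zfc \<Rightarrow> 'v"
  assumes "X \<subseteq> f ` elts x" shows "elts (set_of X) = X"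
proof -
  obtain z where "elts z = f ` elts x" using zfc_replacement[of f x] by metis
  then obtain y where "elts y = X" using zfc_separation[of X z] assms by metis
  moreover from this have "set_of X = y"
    unfolding set_of_def by (intro the_equality) (simp_all add: zfc_extensionality)
  ultimately show ?thesis by simp
qed

text \<open>This is the Mostowski collapse, in which each \<open>v\<close> goes to the set of values
  of its predecessors in \<open>X\<close>. Transitivity of \<open>r\<close> on \<open>X\<close>
  makes the values ordinals, and totality makes the collapse injective.\<close>

lemma ordinal_of_wellorder:
  fixes x :: "'v::zfc"
  assumes X: "X \<subseteq> elts x" and wf: "wf r"
    and tr: "\<And>u v w. \<lbrakk>(u, v) \<in> r; (v, w) \<in> r; u \<in> X; v \<in> X; w \<in> X\<rbrakk> \<Longrightarrow> (u, w) \<in> r"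
    and tot: "\<And>u v. \<lbrakk>u \<in> X; v \<in> X\<rbrakk> \<Longrightarrow> (u, v) \<in> r \<or> u = v \<or> (v, u) \<in> r"
  obtains b f where "Ord b" "bij_betw f X (elts (b :: 'v))"
    "\<And>u v. \<lbrakk>u \<in> X; v \<in> X; (u, v) \<in> r\<rbrakk> \<Longrightarrow> f u \<in> elts (f v)"
proof -
  define F :: "'v \<Rightarrow> 'v" where "F = wfrec r (\<lambda>f v. set_of (f ` {u \<in> X. (u, v) \<in> r}))"
  have F: "elts (F v) = F ` {u \<in> X. (u, v) \<in> r}" for v
  proof -
    have "F v = set_of (cut F r v ` {u \<in> X. (u, v) \<in> r})"
      using wfrec[OF wf, of "\<lambda>f v. set_of (f ` {u \<in> X. (u, v) \<in> r})" v]
      unfolding F_def by simp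
    also have "cut F r v ` {u \<in> X. (u, v) \<in> r} = F ` {u \<in> X. (u, v) \<in> r}"
      by (auto simp: cut_def)
    finally show ?thesis using elts_set_of[of "F ` {u \<in> X. (u, v) \<in> r}" F x] X by auto
  qed
  have eF: "elts (set_of (F ` X)) = F ` X" using elts_set_of[of "F ` X" F x] X by auto
  have OF: "Ord (F v)" if "v \<in> X" for v
    using that
  proof (induction v rule: wf_induct_rule[OF wf])
    case (1 v)
    show ?case
    proof (rule OrdI)
      fix a c assume "a \<in> elts (F v)" "c \<in> elts a"
      then obtain u w where "u \<in> X" "(u, v) \<in> r" "w \<in> X" "(w, u) \<in> r" "c = F w"
        using F by auto
      then show "c \<in> elts (F v)" using F[of v] tr[of w u v] 1(2) by auto
    next
      fix a assume "a \<in> elts (F v)"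
      then show "Ord a" using F 1 by auto
    qed
  qed
  have 1: "Ord (set_of (F ` X))"
    by (rule OrdI) (use eF OF F in auto)
  have mono: "F u \<in> elts (F v)" if "u \<in> X" "v \<in> X" "(u, v) \<in> r" for u v
    using F[of v] that by auto
  have "inj_on F X"
  proof (rule inj_onI)
    fix u v assume "u \<in> X" "v \<in> X" "F u = F v"
    then show "u = v"
      using mono[of u v] mono[of v u] tot[of u v] mem_irrefl[of "F u"] by auto
  qed
  then show ?thesis using that[OF 1, of F] eF mono by (simp add: bij_betw_def)
qed

lemma ordinal_eqpoll: "\<exists>b. Ord b \<and> elts (b :: 'v) \<approx> elts (x :: 'v::zfc)"
proof -
  obtain r where r: "well_order_on (elts x) r" using well_order_on by blast
  have "trans r" "total_on (elts x) r" "antisym r"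
    using r unfolding well_order_on_def linear_order_on_def partial_order_on_def preorder_on_def
    by auto
  note r' = this
  \<comment> \<open>A HOL well-order is reflexive, so the diagonal is removed before
    collapsing.\<close>
  have "wf (r - Id)" using r unfolding well_order_on_def by simp
  obtain b :: 'v and f where "Ord b" "bij_betw f (elts x) (elts b)"
  proof (rule ordinal_of_wellorder[OF order_refl \<open>wf (r - Id)\<close>])
    show "(u, w) \<in> r - Id" if "(u, v) \<in> r - Id" "(v, w) \<in> r - Id" for u v w
      using that transD[OF r'(1)] antisymD[OF r'(3)] by blast
    show "(u, v) \<in> r - Id \<or> u = v \<or> (v, u) \<in> r - Id" if "u \<in> elts x" "v \<in> elts x" for u v
      using that r'(2) unfolding total_on_def by blast
  qed blast
  then have "elts x \<approx> elts b" unfolding eqpoll_def by blast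
  with \<open>Ord b\<close> eqpoll_sym show ?thesis by blast
qed

section \<open>Order types\<close>

text \<open>If \<open>h x\<close> were below \<open>x\<close>, then \<open>h (h x)\<close> would be
  below \<open>h x\<close>, so \<open>h x\<close> would be a smaller counterexample. This rigidity
  of well-orders underlies every comparison of order types below.\<close>

lemma strictly_increasing_ge:
  fixes h :: "'v::zfc \<Rightarrow> 'v"
  assumes X: "\<And>y. y \<in> X \<Longrightarrow> Ord y" and h: "h ` X \<subseteq> X"
    and mono: "\<And>y z. \<lbrakk>y \<in> X; z \<in> X; y \<in> elts z\<rbrakk> \<Longrightarrow> h y \<in> elts (h z)"
    and x: "x \<in> X"
  shows "h x \<notin> elts x"
  using x
proof (induction x rule: mem_induct)
  case (step x)
  have "h x \<in> X" using step.prems h by blast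
  with step mono show ?case by blast
qed

lemma order_iso_inv:
  fixes f :: "'v::zfc \<Rightarrow> 'v"
  assumes f: "bij_betw f X Y" and X: "\<And>x. x \<in> X \<Longrightarrow> Ord x"
    and mono: "\<And>x y. \<lbrakk>x \<in> X; y \<in> X; x \<in> elts y\<rbrakk> \<Longrightarrow> f x \<in> elts (f y)"
    and "u \<in> Y" "v \<in> Y" "u \<in> elts v"
  shows "inv_into X f u \<in> elts (inv_into X f v)"
proof -
  let ?p = "inv_into X f u" and ?q = "inv_into X f v"
  have p: "?p \<in> X" "f ?p = u" and q: "?q \<in> X" "f ?q = v"
    using f assms(4,5) by (auto simp: bij_betw_def inv_into_into f_inv_into_f)
  have "?p \<noteq> ?q" using p(2) q(2) assms(6) mem_irrefl by metis
  moreover have "?q \<notin> elts ?p"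
    using mono[OF q(1) p(1)] p(2) q(2) mem_not_sym[OF assms(6)] by metis
  ultimately show ?thesis using Ord_linear[OF X[OF p(1)] X[OF q(1)]] by metis
qed

definition ord_iso :: "('v::zfc \<Rightarrow> 'v) \<Rightarrow> 'v \<Rightarrow> 'v set \<Rightarrow> bool" where
  "ord_iso f b X \<longleftrightarrow> bij_betw f (elts b) X \<and>
     (\<forall>x\<in>elts b. \<forall>y\<in>elts b. x \<in> elts y \<longrightarrow> f x \<in> elts (f y))"

text \<open>For \<open>b\<close> below \<open>c\<close>, the map \<open>g\<close> followed by the
  inverse of \<open>f\<close> would be increasing from \<open>c\<close> into \<open>b\<close> and so
  would move \<open>b\<close> downwards.\<close>

lemma ord_iso_compare:
  fixes b c :: "'v::zfc"
  assumes "Ord b" "Ord c" "ord_iso f b X" "ord_iso g c X" shows "b \<notin> elts c"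
proof
  assume bc: "b \<in> elts c"
  let ?h = "\<lambda>x. inv_into (elts b) f (g x)"
  have f: "bij_betw f (elts b) X" and g: "bij_betw g (elts c) X"
    using assms unfolding ord_iso_def by auto
  have hb: "?h x \<in> elts b" if "x \<in> elts c" for x
    using f bij_betwE[OF g] that inv_into_into[of "g x" f "elts b"] by (simp add: bij_betw_def)
  have "?h b \<notin> elts b"
  proof (rule strictly_increasing_ge[where X = "elts c" and h = ?h])
    show "?h ` elts c \<subseteq> elts c" using hb Ord_trans[OF assms(2) bc] by auto
    show "?h y \<in> elts (?h z)" if "y \<in> elts c" "z \<in> elts c" "y \<in> elts z" for y z
    proof (rule order_iso_inv[OF f])
      show "g y \<in> X" "g z \<in> X" using g that bij_betwE by blast+
      show "g y \<in> elts (g z)" using assms(4) that unfolding ord_iso_def by blast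
      show "Ord x" if "x \<in> elts b" for x by (rule Ord_in[OF assms(1) that])
    qed (use assms(3) that in \<open>auto simp: ord_iso_def\<close>)
    show "Ord y" if "y \<in> elts c" for y by (rule Ord_in[OF assms(2) that])
  qed (rule bc)
  then show False using hb[OF bc] by blast
qed

text \<open>Collapsing membership on \<open>X\<close> gives existence and
  \<open>ord_iso_compare\<close> gives uniqueness, so the \<open>THE\<close> in \<open>otp\<close>
  denotes.\<close>

lemma otp:
  fixes X :: "'v::zfc set"
  assumes "X \<subseteq> elts a" "Ord a"
  shows "Ord (otp X)" and "\<exists>f. ord_iso f (otp X) X"
proof -
  let ?r = "{(x, y :: 'v). x \<in> elts y}"
  have O: "Ord x" if "x \<in> X" for x using assms(1) that Ord_in[OF assms(2)] by blast
  obtain b :: 'v and f where b: "Ord b" "bij_betw f X (elts (b :: 'v))"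
    "\<And>u v. \<lbrakk>u \<in> X; v \<in> X; (u, v) \<in> ?r\<rbrakk> \<Longrightarrow> f u \<in> elts (f v)"
  proof (rule ordinal_of_wellorder[OF assms(1) zfc_foundation])
    show "(u, w) \<in> ?r" if "(u, v) \<in> ?r" "(v, w) \<in> ?r" "w \<in> X" for u v w
      using that Ord_trans[OF O, of w v u] by simp
    show "(u, v) \<in> ?r \<or> u = v \<or> (v, u) \<in> ?r" if "u \<in> X" "v \<in> X" for u v
      using Ord_linear[OF O O, OF that] by simp
  qed blast
  have "ord_iso (inv_into X f) b X"
    unfolding ord_iso_def
  proof (intro conjI ballI impI)
    show "bij_betw (inv_into X f) (elts b) X" by (rule bij_betw_inv_into[OF b(2)])
    fix x y assume "x \<in> elts b" "y \<in> elts b" "x \<in> elts y"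
    then show "inv_into X f x \<in> elts (inv_into X f y)"
      using order_iso_inv[OF b(2) O] b(3) by simp
  qed
  then have "\<exists>c. Ord c \<and> (\<exists>f. ord_iso f c X)" using b(1) by blast
  moreover have "c = d" if "Ord c \<and> (\<exists>f. ord_iso f c X)" "Ord d \<and> (\<exists>f. ord_iso f d X)" for c d
    using that Ord_linear[of c d] ord_iso_compare[of c d _ X] ord_iso_compare[of d c _ X] by blast
  ultimately have "\<exists>!c. Ord c \<and> (\<exists>f. ord_iso f c X)" by (rule ex_ex1I)
  from theI'[OF this] show "Ord (otp X)" "\<exists>f. ord_iso f (otp X) X"
    unfolding otp_def ord_iso_def by blast+
qed

text \<open>Equal order types would yield an increasing map of \<open>Y\<close> into
  \<open>X\<close>, which sends \<open>z\<close> below itself.\<close>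

lemma otp_initial_segment:
  fixes X Y :: "'v::zfc set"
  assumes "Y \<subseteq> elts a" "Ord a" "X \<subseteq> Y" "z \<in> Y" "X \<subseteq> elts z"
  shows "otp X \<noteq> otp Y"
proof
  assume eq: "otp X = otp Y"
  obtain f g where f: "ord_iso f (otp X) X" and g: "ord_iso g (otp X) Y"
    using otp(2)[of X a] otp(2)[of Y a] eq assms by auto
  have O: "Ord (otp X)" using otp(1)[of X a] assms by auto
  let ?h = "\<lambda>x. f (inv_into (elts (otp X)) g x)"
  have hX: "?h x \<in> X" if "x \<in> Y" for x
    using f g that inv_into_into[of x g "elts (otp X)"]
    unfolding ord_iso_def by (auto simp: bij_betw_def)
  have "?h z \<notin> elts z"
  proof (rule strictly_increasing_ge[where X = Y and h = ?h])
    show "Ord y" if "y \<in> Y" for y using that assms(1) Ord_in[OF assms(2)] by blast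
    show "?h ` Y \<subseteq> Y" using hX assms(3) by blast
    show "?h x \<in> elts (?h y)" if "x \<in> Y" "y \<in> Y" "x \<in> elts y" for x y
      using order_iso_inv[of g "elts (otp X)" Y x y] f g that Ord_in[OF O]
        inv_into_into[of x g "elts (otp X)"] inv_into_into[of y g "elts (otp X)"]
      unfolding ord_iso_def by (auto simp: bij_betw_def)
  qed (rule assms(4))
  then show False using hX assms by blast
qed

section \<open>Cardinality\<close>

lemma lepoll_iff_card_of: "A \<lesssim> B \<longleftrightarrow> (card_of A, card_of B) \<in> ordLeq"
  unfolding lepoll_def card_of_ordLeq ..

lemma UN_lepoll_infinite:
  assumes "infinite B" "I \<lesssim> B" "\<And>i. i \<in> I \<Longrightarrow> F i \<lesssim> B"
  shows "(\<Union>i\<in>I. F i) \<lesssim> B"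
  using card_of_UNION_ordLeq_infinite[OF assms(1), of I F] assms(2,3)
  unfolding lepoll_iff_card_of by blast

lemma countable_lepoll_infinite: "\<lbrakk>infinite B; countable A\<rbrakk> \<Longrightarrow> A \<lesssim> B"
  using countableE[of A] inj_on_image_eqpoll_self lepoll_trans infinite_le_lepoll lepoll_def'
  by (metis Pi_I UNIV_I)

lemma Un_lepoll_infinite:
  assumes "infinite B" "X \<lesssim> B" "Y \<lesssim> B" shows "X \<union> Y \<lesssim> B"
proof -
  have "(\<Union>b\<in>UNIV. if b then X else Y) \<lesssim> B"
    by (rule UN_lepoll_infinite[OF assms(1)])
      (use assms countable_lepoll_infinite[OF assms(1), of "UNIV :: bool set"] in auto)
  moreover have "(\<Union>b\<in>UNIV. if b then X else Y) = X \<union> Y" by (auto split: if_splits)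
  ultimately show ?thesis by simp
qed

lemma lists_lepoll_infinite:
  fixes Y :: "'a set"
  assumes B: "infinite B" and Y: "Y \<lesssim> B"
  shows "lists Y \<lesssim> B"
proof -
  have n: "{xs. length xs = n \<and> set xs \<subseteq> Y} \<lesssim> B" for n
  proof (induction n)
    case 0
    have "{xs. length xs = 0 \<and> set xs \<subseteq> Y} = {[]}" by auto
    then show ?case using finite_lepoll_infinite[OF B, of "{[] :: 'a list}"] by simp
  next
    case (Suc n)
    let ?L = "{xs. length xs = n \<and> set xs \<subseteq> Y}"
    have "(\<Union>y\<in>Y. (#) y ` ?L) \<lesssim> B"
      by (intro UN_lepoll_infinite[OF B Y] lepoll_trans[OF image_lepoll Suc.IH])
    moreover have "{xs. length xs = Suc n \<and> set xs \<subseteq> Y} = (\<Union>y\<in>Y. (#) y ` ?L)"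
      by (auto simp: length_Suc_conv)
    ultimately show ?case by simp
  qed
  have "lists Y = (\<Union>n. {xs. length xs = n \<and> set xs \<subseteq> Y})" by auto
  moreover have "\<dots> \<lesssim> B" by (rule UN_lepoll_infinite[OF B B[unfolded infinite_le_lepoll] n])
  ultimately show ?thesis by simp
qed

text \<open>An operation maps a list of any length to a set of values, so a single
  \<open>ops\<close> can hold all functions of an algebra together with all its Skolem
  functions.\<close>

definition closed_under :: "('a list \<Rightarrow> 'a set) \<Rightarrow> 'a set \<Rightarrow> bool" where
  "closed_under ops Y \<longleftrightarrow> (\<forall>xs. set xs \<subseteq> Y \<longrightarrow> ops xs \<subseteq> Y)"

definition hull_under :: "('a list \<Rightarrow> 'a set) \<Rightarrow> 'a set \<Rightarrow> 'a set" where
  "hull_under ops X = \<Inter> {Y. X \<subseteq> Y \<and> closed_under ops Y}"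

lemma subset_hull_under: "X \<subseteq> hull_under ops X"
  unfolding hull_under_def by blast

lemma closed_hull_under: "closed_under ops (hull_under ops X)"
  unfolding hull_under_def closed_under_def by blast

lemma hull_under_minimal: "\<lbrakk>X \<subseteq> Y; closed_under ops Y\<rbrakk> \<Longrightarrow> hull_under ops X \<subseteq> Y"
  unfolding hull_under_def by blast

text \<open>The operations are finitary, so by directedness each argument list already lies in one
  member of the family.\<close>

lemma closed_under_directed_Union:
  assumes "\<And>Y. Y \<in> F \<Longrightarrow> closed_under ops Y" "F \<noteq> {}"
    and "\<And>Y Z. \<lbrakk>Y \<in> F; Z \<in> F\<rbrakk> \<Longrightarrow> \<exists>W\<in>F. Y \<union> Z \<subseteq> W"
  shows "closed_under ops (\<Union>F)"
  unfolding closed_under_def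
proof (intro allI impI)
  fix xs assume "set xs \<subseteq> \<Union>F"
  moreover have "\<exists>Y\<in>F. S \<subseteq> Y" if "finite S" "S \<subseteq> \<Union>F" for S
    using that
  proof (induction S)
    case empty then show ?case using assms(2) by blast
  next
    case (insert x S)
    then obtain Y Z where YZ: "Y \<in> F" "S \<subseteq> Y" "Z \<in> F" "x \<in> Z" by blast
    then obtain W where "W \<in> F" "Y \<union> Z \<subseteq> W" using assms(3) by metis
    then show ?case using YZ by blast
  qed
  ultimately obtain Y where "Y \<in> F" "set xs \<subseteq> Y" by blast
  then show "ops xs \<subseteq> \<Union>F" using assms(1) unfolding closed_under_def by blast
qed

text \<open>The hull is reached after \<omega> rounds, and each round adds countably many values for
  each of at most \<open>B\<close> many lists.\<close>

lemma hull_under_lepoll: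
  assumes B: "infinite B" and X: "X \<lesssim> B" and ops: "\<And>xs. countable (ops xs)"
  shows "hull_under ops X \<lesssim> B"
proof -
  define G where "G Y = Y \<union> \<Union> (ops ` lists Y)" for Y
  define Z where "Z n = (G ^^ n) X" for n
  have Z0: "Z 0 = X" and ZS: "Z (Suc n) = G (Z n)" for n by (auto simp: Z_def)
  have small: "Z n \<lesssim> B" for n
  proof (induction n)
    case 0 then show ?case using X Z0 by simp
  next
    case (Suc n)
    have "\<Union> (ops ` lists (Z n)) \<lesssim> B"
      by (intro UN_lepoll_infinite[OF B lists_lepoll_infinite[OF B Suc]]
        countable_lepoll_infinite[OF B ops])
    from Un_lepoll_infinite[OF B Suc this] show ?case by (simp add: ZS G_def)
  qed
  have mono: "Z m \<subseteq> Z n" if "m \<le> n" for m n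
    by (rule lift_Suc_mono_le[of Z, OF _ that]) (simp add: ZS G_def)
  have "closed_under ops (\<Union> (range Z))"
    unfolding closed_under_def
  proof (intro allI impI)
    fix xs assume "set xs \<subseteq> \<Union> (range Z)"
    then have "\<exists>n. set xs \<subseteq> Z n"
    proof (induction xs)
      case (Cons x xs)
      then obtain m n where "x \<in> Z m" "set xs \<subseteq> Z n" by auto
      then have "set (x # xs) \<subseteq> Z (max m n)" using mono[of m "max m n"] mono[of n "max m n"] by auto
      then show ?case by blast
    qed simp
    then obtain n where "set xs \<subseteq> Z n" by blast
    then have "ops xs \<subseteq> Z (Suc n)" unfolding ZS G_def by (auto simp: lists_eq_set)
    then show "ops xs \<subseteq> \<Union> (range Z)" by blast
  qed
  moreover have "X \<subseteq> \<Union> (range Z)" using Z0 by blast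
  ultimately have "hull_under ops X \<subseteq> (\<Union>n. Z n)" by (rule hull_under_minimal[rotated])
  moreover have "(\<Union>n. Z n) \<lesssim> B"
    by (intro UN_lepoll_infinite[OF B] small B[unfolded infinite_le_lepoll])
  ultimately show ?thesis using lepoll_trans[OF subset_imp_lepoll] by metis
qed

section \<open>Cardinals and regularity\<close>

lemma Card_Ord: "Card k \<Longrightarrow> Ord k"
  by (simp add: Card_def)

lemma Card_of_Ord:
  fixes a :: "'v::zfc"
  assumes "Ord a"
  obtains c :: 'v where "Card c" "elts c \<approx> elts a" "elts c \<subseteq> elts a"
proof -
  let ?P = "\<lambda>c :: 'v. elts c \<approx> elts a"
  let ?c = "least_ord ?P"
  note l = least_ord[of a ?P, OF assms eqpoll_refl]
  have "Card ?c"
    unfolding Card_def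
  proof (intro conjI ballI)
    fix d assume d: "d \<in> elts ?c"
    have "elts d \<lesssim> elts ?c" by (rule subset_imp_lepoll[OF Ord_subset[OF l(1) d]])
    moreover have "\<not> elts d \<approx> elts ?c" using l(3)[OF d] eqpoll_trans[OF _ l(2)] by metis
    ultimately show "elts d \<prec> elts ?c" by (simp add: lepoll_iff_leqpoll)
  qed (rule l(1))
  then show ?thesis using that[of ?c] l(2) l(4)[OF assms eqpoll_refl] by blast
qed

text \<open>By Cantor's theorem the power set of \<open>a\<close> is larger than \<open>a\<close>; a
  cardinal of its size cannot be a subset of \<open>a\<close>, hence lies above it.\<close>

lemma Card_above:
  fixes a :: "'v::zfc"
  assumes "Ord a"
  shows "\<exists>c :: 'v. Card c \<and> a \<in> elts c"
proof -
  obtain p where p: "elts p = {y. elts y \<subseteq> elts a}" using zfc_power[of a] by blast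
  have "Pow (elts a) \<subseteq> elts ` elts p"
  proof
    fix Y assume "Y \<in> Pow (elts a)"
    then show "Y \<in> elts ` elts p" using p zfc_separation[of Y a] by auto
  qed
  from lesspoll_trans2[OF lesspoll_Pow_self subset_image_lepoll[OF this]]
  have "elts a \<prec> elts p" .
  moreover obtain b :: 'v where b: "Ord b" "elts b \<approx> elts p" using ordinal_eqpoll[of p] by auto
  moreover obtain c :: 'v where c: "Card c" "elts c \<approx> elts b" using Card_of_Ord[OF b(1)] by metis
  ultimately have "elts a \<prec> elts c"
    using lesspoll_eq_trans[OF _ eqpoll_sym[OF eqpoll_trans[OF c(2) b(2)]]] by metis
  then have "\<not> elts c \<subseteq> elts a"
    using lesspoll_trans1[OF subset_imp_lepoll, of "elts c" "elts a" "elts c"]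
      lesspoll_not_refl[of "elts c"] by metis
  then show ?thesis using Ord_not_mem[OF assms Card_Ord[OF c(1)]] c(1) by metis
qed

lemma csucc:
  assumes "Ord a"
  shows "Card (csucc a)" and "a \<in> elts (csucc a)"
    and "\<And>k. \<lbrakk>Card k; a \<in> elts k\<rbrakk> \<Longrightarrow> elts (csucc a) \<subseteq> elts k"
proof -
  let ?P = "\<lambda>k. Card k \<and> a \<in> elts k"
  obtain c where c: "?P c" using Card_above[OF assms] by blast
  note l = least_ord[where P = ?P, OF Card_Ord c, folded csucc_def, OF conjunct1[OF c]]
  show "Card (csucc a)" "a \<in> elts (csucc a)" using l(2) by auto
  show "elts (csucc a) \<subseteq> elts k" if "Card k" "a \<in> elts k" for k
    using l(4)[OF Card_Ord[OF that(1)]] that by blast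
qed

text \<open>The cardinality of \<open>x\<close> is a cardinal below \<open>csucc a\<close>, so by
  minimality of \<open>csucc a\<close> it does not exceed \<open>a\<close>.\<close>

lemma mem_csucc_lepoll:
  assumes "Ord a" "x \<in> elts (csucc a)"
  shows "elts x \<lesssim> elts a"
proof -
  note k = csucc[OF assms(1)]
  have x: "Ord x" using Ord_in[OF Card_Ord[OF k(1)] assms(2)] .
  obtain c where c: "Card c" "elts c \<approx> elts x" "elts c \<subseteq> elts x" using Card_of_Ord[OF x] by metis
  have "c \<in> elts (csucc a)"
    using Ord_mem_subset_trans[OF Card_Ord[OF c(1)] x c(3) assms(2) Card_Ord[OF k(1)]] .
  then have "a \<notin> elts c" using k(3)[OF c(1)] mem_irrefl[of c] by auto
  then have "elts c \<lesssim> elts a"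
    by (intro subset_imp_lepoll Ord_not_mem[OF assms(1) Card_Ord[OF c(1)]])
  with c(2) show ?thesis using lepoll_trans1[OF eqpoll_sym] by metis
qed

text \<open>Adding one element does not enlarge an infinite set, so an infinite cardinal cannot be a
  successor ordinal.\<close>

lemma InfCard_Limit:
  assumes "InfCard k" shows "Limit k"
  unfolding Limit_def
proof (intro conjI ballI)
  have k: "Card k" "Ord k" "infinite (elts k)" using assms by (auto simp: InfCard_def Card_def)
  show "Ord k" "elts k \<noteq> {}" using k by auto
  fix x assume x: "x \<in> elts k"
  have o: "Ord x" by (rule Ord_in[OF k(2) x])
  show "osucc x \<in> elts k"
  proof (rule ccontr)
    assume "osucc x \<notin> elts k"
    then have "elts k \<subseteq> insert x (elts x)"
      using Ord_not_mem[OF Ord_osucc[OF o] k(2)] elts_osucc[OF o] by simp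
    moreover from this have "infinite (elts x)" using k(3) finite_subset by blast
    ultimately have "elts k \<lesssim> elts x"
      using lepoll_trans[OF subset_imp_lepoll infinite_insert_lepoll] by metis
    moreover have "elts x \<prec> elts k" using x k(1) unfolding Card_def by simp
    ultimately show False using lesspoll_trans1 lesspoll_not_refl by metis
  qed
qed

text \<open>The predicate minimised in \<open>cf\<close>. The map need not be increasing, and its
  values bound only non-strictly.\<close>

definition cofinal_map :: "('v::zfc \<Rightarrow> 'v) \<Rightarrow> 'v \<Rightarrow> 'v \<Rightarrow> bool" where
  "cofinal_map f b a \<longleftrightarrow> f ` elts b \<subseteq> elts a \<and>
     (\<forall>x\<in>elts a. \<exists>y\<in>elts b. elts x \<subseteq> elts (f y))"

lemma cf:
  assumes "Ord a"
  shows "Ord (cf a)" and "\<exists>f. cofinal_map f (cf a) a"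
    and "\<And>b f. b \<in> elts (cf a) \<Longrightarrow> \<not> cofinal_map f b a"
    and "\<And>b f. \<lbrakk>Ord b; cofinal_map f b a\<rbrakk> \<Longrightarrow> elts (cf a) \<subseteq> elts b"
proof -
  let ?P = "\<lambda>b. \<exists>f. cofinal_map f b a"
  have eq: "cf a = least_ord ?P" unfolding cf_def cofinal_map_def ..
  have P: "?P a" unfolding cofinal_map_def by (rule exI[of _ id]) auto
  note l = least_ord[where P = ?P, OF assms P, folded eq]
  show "Ord (cf a)" "\<exists>f. cofinal_map f (cf a) a" by (rule l(1), rule l(2))
  show "\<not> cofinal_map f b a" if "b \<in> elts (cf a)" for b f using l(3)[OF that] by blast
  show "elts (cf a) \<subseteq> elts b" if "Ord b" "cofinal_map f b a" for b f
    using l(4)[OF that(1)] that(2) by blast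
qed

lemma regular_card_Limit: "regular_card k \<Longrightarrow> Limit k"
  by (simp add: regular_card_def InfCard_Limit)

text \<open>A subset of size at most \<open>b\<close> is covered by a function on \<open>b\<close>,
  which cannot be cofinal since \<open>b\<close> is below \<open>cf k = k\<close>.\<close>

lemma regular_bounded:
  fixes k :: "'v::zfc"
  assumes k: "regular_card k" and b: "b \<in> elts k" and X: "X \<subseteq> elts k" "X \<lesssim> elts b"
  shows "\<exists>x\<in>elts k. \<forall>y\<in>X. y \<in> elts x"
proof (cases "X = {}")
  case True
  then show ?thesis using b by blast
next
  case False
  then obtain x0 where x0: "x0 \<in> X" by blast
  obtain g where g: "X \<subseteq> g ` elts b" using X(2) lepoll_iff by metis
  \<comment> \<open>Values outside \<open>X\<close> are redirected to \<open>x0\<close>, so that the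
    map stays inside \<open>k\<close>.\<close>
  let ?f = "\<lambda>y. if g y \<in> X then g y else x0"
  have o: "Ord k" using Limit_Ord[OF regular_card_Limit[OF k]] .
  have "\<not> cofinal_map ?f b k"
    using cf(3)[OF o, of b ?f] k b unfolding regular_card_def by simp
  moreover have "?f ` elts b \<subseteq> elts k" using X(1) x0 by auto
  ultimately obtain x where x: "x \<in> elts k" "\<And>y. y \<in> elts b \<Longrightarrow> \<not> elts x \<subseteq> elts (?f y)"
    unfolding cofinal_map_def by blast
  have "y \<in> elts x" if y: "y \<in> X" for y
  proof -
    obtain z where "z \<in> elts b" "y = g z" using g y by blast
    then have "\<not> elts x \<subseteq> elts y" using x(2)[of z] y by simp
    then show ?thesis
      using Ord_not_mem[OF Ord_in[OF o] Ord_in[OF o x(1)], of y] y X(1) by blast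
  qed
  then show ?thesis using x(1) by blast
qed

lemma omega_Limit:
  fixes k :: "'v::zfc"
  assumes "Limit k" shows "Limit (omega :: 'v)"
  unfolding omega_def by (rule least_ord(2)[OF Limit_Ord[OF assms], where P = Limit, OF assms])

lemma omega_subset:
  fixes k :: "'v::zfc"
  assumes "Limit k" shows "elts (omega :: 'v) \<subseteq> elts k"
  unfolding omega_def
  by (rule least_ord(4)[OF Limit_Ord[OF assms], where P = Limit, OF assms Limit_Ord[OF assms] assms])

lemma regular_bounded_nat:
  fixes s :: "nat \<Rightarrow> 'v::zfc"
  assumes "regular_card k" "omega \<in> elts k" "range s \<subseteq> elts k"
  shows "\<exists>x\<in>elts k. \<forall>n. s n \<in> elts x"
proof -
  have "infinite (elts (omega :: 'v))"
    using infinite_Limit[OF omega_Limit[OF regular_card_Limit[OF assms(1)]]] .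
  then have "range s \<lesssim> elts (omega :: 'v)" by (rule countable_lepoll_infinite) simp
  from regular_bounded[OF assms(1,2,3) this] show ?thesis by auto
qed

text \<open>With a smaller cofinality, \<open>csucc a\<close> would be a union of at most
  \<open>a\<close> many sets, each of size at most that of \<open>a\<close>.\<close>

lemma regular_csucc:
  fixes a :: "'v::zfc"
  assumes a: "Ord a" "infinite (elts a)"
  shows "regular_card (csucc a)"
proof -
  let ?k = "csucc a"
  note c = csucc[OF a(1)]
  have o: "Ord ?k" by (rule Card_Ord[OF c(1)])
  have I: "InfCard ?k"
    unfolding InfCard_def using c(1) infinite_super[OF Ord_subset[OF o c(2)] a(2)] by simp
  have L: "Limit ?k" by (rule InfCard_Limit[OF I])
  have "cf ?k \<notin> elts ?k"
  proof
    assume b: "cf ?k \<in> elts ?k"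
    obtain f where f: "cofinal_map f (cf ?k) ?k" using cf(2)[OF o] by blast
    have "(\<Union>y\<in>elts (cf ?k). elts (f y)) \<lesssim> elts a"
    proof (rule UN_lepoll_infinite[OF a(2) mem_csucc_lepoll[OF a(1) b]])
      show "elts (f y) \<lesssim> elts a" if "y \<in> elts (cf ?k)" for y
        by (rule mem_csucc_lepoll[OF a(1)]) (use f that in \<open>auto simp: cofinal_map_def\<close>)
    qed
    moreover have "elts ?k \<subseteq> (\<Union>y\<in>elts (cf ?k). elts (f y))"
    proof
      fix x assume "x \<in> elts ?k"
      then obtain z where "z \<in> elts ?k" "x \<in> elts z" using Limit_above[OF L] by blast
      then show "x \<in> (\<Union>y\<in>elts (cf ?k). elts (f y))" using f unfolding cofinal_map_def by blast
    qed
    ultimately have "elts ?k \<lesssim> elts a" using lepoll_trans[OF subset_imp_lepoll] by metis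
    moreover have "elts a \<prec> elts ?k" using c(1,2) unfolding Card_def by simp
    ultimately show False using lesspoll_trans1 lesspoll_not_refl by metis
  qed
  moreover have "elts (cf ?k) \<subseteq> elts ?k"
    by (rule cf(4)[OF o o, where f = id]) (auto simp: cofinal_map_def)
  ultimately have "cf ?k = ?k" using Ord_subset_cases[OF cf(1)[OF o] o] by blast
  then show ?thesis using I unfolding regular_card_def by blast
qed

section \<open>Closure points and pressing down\<close>

text \<open>Iterate the step function \<omega> times and take the supremum, which stays below
  \<open>k\<close> because \<open>k\<close> is regular and uncountable. Consecutive iterates provide
  the pairs \<open>c\<close>, \<open>d\<close>.\<close>

lemma closure_point:
  fixes k :: "'v::zfc"
  assumes k: "regular_card k" "omega \<in> elts k"
    and step: "\<And>a. a \<in> elts k \<Longrightarrow> \<exists>b\<in>elts k. a \<in> elts b \<and> Q a b"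
    and a: "a \<in> elts k"
  obtains x where "x \<in> elts k" "Limit x" "a \<in> elts x"
    "\<And>b. b \<in> elts x \<Longrightarrow> \<exists>c\<in>elts x. \<exists>d\<in>elts x. b \<in> elts c \<and> c \<in> elts d \<and> Q c d"
proof -
  obtain h where h: "\<And>a. a \<in> elts k \<Longrightarrow> h a \<in> elts k \<and> a \<in> elts (h a) \<and> Q a (h a)"
    using step by metis
  define s where "s n = (h ^^ n) a" for n
  have s0: "s 0 = a" and sS: "s (Suc n) = h (s n)" for n by (auto simp: s_def)
  have sk: "s n \<in> elts k" for n by (induction n) (use a h s0 sS in auto)
  have o: "Ord k" by (rule Limit_Ord[OF regular_card_Limit[OF k(1)]])
  obtain y where y: "y \<in> elts k" "\<And>n. s n \<in> elts y"
    using regular_bounded_nat[OF k, of s] sk by blast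
  have oy: "Ord y" by (rule Ord_in[OF o y(1)])
  define x where "x = osup (range s)"
  have X: "range s \<subseteq> elts y" using y(2) by blast
  have ox: "Ord x" and ex: "elts x = (\<Union>n. elts (s n))"
    using osup[OF X] Ord_in[OF oy] y(2) unfolding x_def by auto
  have "elts x \<subseteq> elts y" using ex y(2) Ord_subset[OF oy] by blast
  then have xk: "x \<in> elts k" by (rule Ord_mem_subset_trans[OF ox oy _ y(1) o])
  have sx: "s n \<in> elts x" for n
  proof -
    have "s n \<in> elts (s (Suc n))" using h[OF sk[of n]] sS by simp
    then show ?thesis unfolding ex by blast
  qed
  have clos: "\<exists>c\<in>elts x. \<exists>d\<in>elts x. b \<in> elts c \<and> c \<in> elts d \<and> Q c d" if b: "b \<in> elts x" for b
  proof -
    obtain n where "b \<in> elts (s n)" using b ex by auto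
    then show ?thesis using sx[of n] sx[of "Suc n"] h[OF sk[of n]] sS[of n] by auto
  qed
  have "Limit x" by (rule LimitI[OF ox]) (use sx clos in blast)+
  then show ?thesis using that[OF xk _ _ clos] sx[of 0] s0 by auto
qed

text \<open>Unboundedness comes from a closure point of a relation that interleaves all
  \<open>D d\<close> with smaller index. The conditions \<open>Limit b\<close> and
  \<open>omega \<in> elts b\<close> are built in, so pressing down needs no further intersection of
  clubs.\<close>

lemma club_diagonal_intersection:
  fixes k :: "'v::zfc"
  assumes k: "regular_card k" "omega \<in> elts k" and D: "\<And>d. d \<in> elts k \<Longrightarrow> club (D d) k"
  shows "club {b \<in> elts k. Limit b \<and> omega \<in> elts b \<and> (\<forall>d\<in>elts b. b \<in> D d)} k"
    (is "club ?E k")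
  unfolding club_def
proof (intro conjI ballI impI)
  have o: "Ord k" by (rule Limit_Ord[OF regular_card_Limit[OF k(1)]])
  show "?E \<subseteq> elts k" by blast
  fix a assume a: "a \<in> elts k"
  \<comment> \<open>Each club indexed below \<open>a\<close> is to have a point between
    \<open>a\<close> and \<open>b\<close>.\<close>
  let ?Q = "\<lambda>a b. omega \<in> elts b \<and> (\<forall>d\<in>elts a. \<exists>y\<in>D d. a \<in> elts y \<and> y \<in> elts b)"
  have "\<exists>b\<in>elts k. a \<in> elts b \<and> ?Q a b" if a: "a \<in> elts k" for a
  proof -
    have "\<exists>y. y \<in> D d \<and> a \<in> elts y" if "d \<in> elts a" for d
      using D[OF Ord_trans[OF o a that]] a unfolding club_def by blast
    then obtain g where g: "\<And>d. d \<in> elts a \<Longrightarrow> g d \<in> D d \<and> a \<in> elts (g d)" by metis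
    have gk: "g d \<in> elts k" if "d \<in> elts a" for d
      using g[OF that] D[OF Ord_trans[OF o a that]] unfolding club_def by blast
    obtain u where u: "u \<in> elts k" "\<forall>y\<in>g ` elts a. y \<in> elts u"
      using regular_bounded[OF k(1) a, of "g ` elts a"] gk image_lepoll[of g "elts a"] by auto
    have "infinite (elts (omega :: 'v))"
      using infinite_Limit[OF omega_Limit[OF regular_card_Limit[OF k(1)]]] .
    then have "{u, a, omega} \<lesssim> elts (omega :: 'v)" by (rule finite_lepoll_infinite) simp
    then obtain b where b: "b \<in> elts k" "\<forall>y\<in>{u, a, omega}. y \<in> elts b"
      using regular_bounded[OF k, of "{u, a, omega}"] u(1) a k(2) by auto
    then have "elts u \<subseteq> elts b" using Ord_subset[OF Ord_in[OF o b(1)]] by blast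
    then show ?thesis using b g u(2) by blast
  qed
  from closure_point[OF k, of ?Q, OF this a] obtain x
    where x: "x \<in> elts k" "Limit x" "a \<in> elts x"
      "\<And>b. b \<in> elts x \<Longrightarrow> \<exists>c\<in>elts x. \<exists>d\<in>elts x. b \<in> elts c \<and> c \<in> elts d \<and> ?Q c d"
    by metis
  have ox: "Ord x" by (rule Limit_Ord[OF x(2)])
  have "omega \<in> elts x" using x(4)[OF x(3)] Ord_trans[OF ox] by blast
  moreover have "x \<in> D d" if d: "d \<in> elts x" for d
  proof -
    have "\<exists>y\<in>D d \<inter> elts x. z \<in> elts y" if z: "z \<in> elts x" for z
    proof -
      \<comment> \<open>The point \<open>w\<close> lies above \<open>d\<close> as well as
        \<open>z\<close>: a pair \<open>c\<close>, \<open>e\<close> beyond \<open>w\<close> then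
        satisfies \<open>?Q\<close> with \<open>d\<close> among the indices.\<close>
      obtain w where w: "w \<in> elts x" "z \<in> elts w" "d \<in> elts w"
      proof (cases "z \<in> elts d")
        case True
        obtain w where "w \<in> elts x" "d \<in> elts w" using Limit_above[OF x(2) d] by blast
        then show ?thesis using that True Ord_trans[OF Ord_in[OF ox], of w d z] by metis
      next
        case False
        then have "d \<in> elts z \<or> d = z" using Ord_linear[OF Ord_in[OF ox d] Ord_in[OF ox z]] by metis
        moreover obtain w where "w \<in> elts x" "z \<in> elts w" using Limit_above[OF x(2) z] by blast
        ultimately show ?thesis using that Ord_trans[OF Ord_in[OF ox], of w z d] by metis
      qed
      obtain c e where c: "c \<in> elts x" "e \<in> elts x" "w \<in> elts c" "?Q c e" using x(4)[OF w(1)] by blast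
      have oc: "Ord c" by (rule Ord_in[OF ox c(1)])
      obtain y where y: "y \<in> D d" "c \<in> elts y" "y \<in> elts e"
        using c(4) Ord_trans[OF oc c(3) w(3)] by blast
      have yx: "y \<in> elts x" by (rule Ord_trans[OF ox c(2) y(3)])
      have "z \<in> elts y"
        using Ord_trans[OF Ord_in[OF ox yx] y(2) Ord_trans[OF oc c(3) w(2)]] .
      then show ?thesis using y(1) yx by blast
    qed
    then have "limit_point x (D d)" unfolding limit_point_def using x(2) by blast
    then show ?thesis using D[OF Ord_trans[OF o x(1) d]] x(1) unfolding club_def by blast
  qed
  ultimately show "\<exists>y\<in>?E. a \<in> elts y" using x by blast
next
  have o: "Ord k" by (rule Limit_Ord[OF regular_card_Limit[OF k(1)]])
  fix b assume b: "b \<in> elts k" "limit_point b ?E"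
  have L: "Limit b" using b(2) unfolding limit_point_def by blast
  have ob: "Ord b" by (rule Limit_Ord[OF L])
  have lim: "\<exists>y\<in>elts b. x \<in> elts y \<and> y \<in> ?E" if "x \<in> elts b" for x
    using b(2) that unfolding limit_point_def by blast
  obtain x where "x \<in> elts b" using L unfolding Limit_def by blast
  then have "omega \<in> elts b" using lim Ord_trans[OF ob] by blast
  moreover have "b \<in> D d" if d: "d \<in> elts b" for d
  proof -
    have "\<exists>y\<in>D d \<inter> elts b. x \<in> elts y" if x: "x \<in> elts b" for x
    proof -
      obtain y where y: "y \<in> elts b" "x \<in> elts y" "y \<in> ?E" using lim[OF x] by blast
      \<comment> \<open>A point \<open>y\<close> not above \<open>d\<close> need not belong to
        \<open>D d\<close>; in that case \<open>e\<close> is above \<open>d\<close>, hence in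
        \<open>D d\<close>, and also above \<open>x\<close>.\<close>
      obtain e where e: "e \<in> elts b" "d \<in> elts e" "e \<in> ?E" using lim[OF d] by blast
      have oy: "Ord y" and oe: "Ord e" using y(1) e(1) Ord_in[OF ob] by auto
      show ?thesis
      proof (cases "d \<in> elts y")
        case True then show ?thesis using y by blast
      next
        case False
        then have "elts y \<subseteq> elts d" using Ord_not_mem[OF Ord_in[OF ob d] oy] by blast
        then have "x \<in> elts e" using y(2) Ord_trans[OF oe e(2)] by blast
        then show ?thesis using e by blast
      qed
    qed
    then have "limit_point b (D d)" unfolding limit_point_def using L by blast
    then show ?thesis using D[OF Ord_trans[OF o b(1) d]] b(1) unfolding club_def by blast
  qed
  ultimately show "b \<in> ?E" using b(1) L by blast
qed

text \<open>Fodor's lemma. If every level set missed some club \<open>D d\<close>, a point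
  \<open>b\<close> of \<open>S\<close> in the diagonal intersection would lie in
  \<open>D (f b)\<close>, because \<open>f b\<close> is below \<open>b\<close>.\<close>

lemma pressing_down:
  fixes k :: "'v::zfc"
  assumes k: "regular_card k" "omega \<in> elts k" and S: "stationary S k"
    and f: "\<And>b. \<lbrakk>b \<in> S; Limit b; omega \<in> elts b\<rbrakk> \<Longrightarrow> f b \<in> elts b"
  shows "\<exists>d. stationary {b \<in> S. Limit b \<and> omega \<in> elts b \<and> f b = d} k"
proof (rule ccontr)
  let ?S = "\<lambda>d. {b \<in> S. Limit b \<and> omega \<in> elts b \<and> f b = d}"
  assume neg: "\<nexists>d. stationary (?S d) k"
  have "\<exists>D. club D k \<and> ?S d \<inter> D = {}" for d
  proof -
    have "?S d \<subseteq> elts k" using S unfolding stationary_def by blast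
    then show ?thesis using neg unfolding stationary_def by blast
  qed
  then obtain D where D: "\<And>d. club (D d) k" "\<And>d. ?S d \<inter> D d = {}" by metis
  obtain b where "b \<in> S" "b \<in> {b \<in> elts k. Limit b \<and> omega \<in> elts b \<and> (\<forall>d\<in>elts b. b \<in> D d)}"
    using S club_diagonal_intersection[OF k, of D] D(1) unfolding stationary_def by blast
  then have "b \<in> ?S (f b) \<inter> D (f b)" using f by blast
  then show False using D(2) by blast
qed

section \<open>Skolem hulls\<close>

instance tm :: countable by countable_datatype
instance fm :: countable by countable_datatype

fun tm_vars :: "tm \<Rightarrow> nat set" where
  "tm_vars (Var n) = {n}"
| "tm_vars (Fun i ts) = \<Union> (tm_vars ` set ts)"

fun fm_vars :: "fm \<Rightarrow> nat set" where
  "fm_vars (Eq s t) = tm_vars s \<union> tm_vars t"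
| "fm_vars (Rel i ts) = \<Union> (tm_vars ` set ts)"
| "fm_vars (Neg p) = fm_vars p"
| "fm_vars (Conj p q) = fm_vars p \<union> fm_vars q"
| "fm_vars (Ex n p) = insert n (fm_vars p)"

lemma finite_tm_vars: "finite (tm_vars t)"
  by (induction t) auto

lemma finite_fm_vars: "finite (fm_vars p)"
  by (induction p) (auto simp: finite_tm_vars)

lemma tm_val_cong: "(\<And>n. n \<in> tm_vars t \<Longrightarrow> e n = e' n) \<Longrightarrow> tm_val M e t = tm_val M e' t"
proof (induction t)
  case (Fun i ts)
  then have "map (tm_val M e) ts = map (tm_val M e') ts" by (intro map_cong) auto
  then show ?case by (simp only: tm_val.simps)
qed simp

lemma sat_cong: "(\<And>n. n \<in> fm_vars p \<Longrightarrow> e n = e' n) \<Longrightarrow> sat A M e p = sat A M e' p"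
proof (induction p arbitrary: e e')
  case (Eq s t)
  then show ?case using tm_val_cong[of s e e' M] tm_val_cong[of t e e' M] by simp
next
  case (Rel i ts)
  then have "map (tm_val M e) ts = map (tm_val M e') ts" by (intro map_cong tm_val_cong) auto
  then show ?case by (simp only: sat.simps)
next
  case (Neg p)
  have "sat A M e p = sat A M e' p" by (rule Neg.IH, rule Neg.prems) simp
  then show ?case by (simp only: sat.simps)
next
  case (Conj p q)
  have "sat A M e p = sat A M e' p" by (rule Conj.IH(1), rule Conj.prems) simp
  moreover have "sat A M e q = sat A M e' q" by (rule Conj.IH(2), rule Conj.prems) simp
  ultimately show ?case by (simp only: sat.simps)
next
  case (Ex n p)
  have "sat A M (e(n := a)) p = sat A M (e'(n := a)) p" for a
    by (rule Ex.IH) (simp add: Ex.prems)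
  then show ?case by (simp only: sat.simps)
qed

text \<open>Finite lists stand for environments; variables beyond the end of the list take the
  unspecified value of \<^term>\<open>xs ! i\<close>, so a list only serves formulas whose variables it covers.\<close>

definition skolem_ops :: "'a set \<Rightarrow> 'a alg \<Rightarrow> 'a list \<Rightarrow> 'a set" where
  "skolem_ops A M xs = (\<lambda>i. fun_of M i xs) ` {i. length xs = fun_arity M i} \<union>
     (\<lambda>(p, n). SOME a. a \<in> A \<and> sat A M (((!) xs)(n := a)) p) `
       {(p, n). \<exists>a\<in>A. sat A M (((!) xs)(n := a)) p}"

text \<open>Function symbols are indexed by natural numbers, and pairs of a formula and a variable
  form a countable type.\<close>

lemma countable_skolem_ops: "countable (skolem_ops A M xs)"
  unfolding skolem_ops_def by (intro countable_Un countable_image countableI_type)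

lemma closed_skolem_ops:
  assumes "algebra_on A M" shows "closed_under (skolem_ops A M) A"
  unfolding closed_under_def
proof (intro allI impI subsetI)
  fix xs x assume xs: "set xs \<subseteq> A" and x: "x \<in> skolem_ops A M xs"
  from x consider i where "length xs = fun_arity M i" "x = fun_of M i xs"
    | p n where "\<exists>a. a \<in> A \<and> sat A M (((!) xs)(n := a)) p"
      "x = (SOME a. a \<in> A \<and> sat A M (((!) xs)(n := a)) p)"
    unfolding skolem_ops_def by auto
  then show "x \<in> A"
  proof cases
    case 1 then show ?thesis using assms xs unfolding algebra_on_def by simp
  next
    case 2 then show ?thesis using someI_ex[OF 2(1)] by simp
  qed
qed

text \<open>The Tarski-Vaught test: only the existential case matters, and there the chosen Skolem
  witness lies in \<open>N\<close> by closure.\<close>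

lemma elementary_sub_skolem:
  assumes N: "closed_under (skolem_ops A M) N" "N \<subseteq> A" "N \<noteq> {}"
  shows "elementary_sub N A M"
proof -
  have "sat N M e p = sat A M e p" if "range e \<subseteq> N" for p e
    using that
  proof (induction p arbitrary: e)
    case (Ex n p)
    have IH: "sat N M (e(n := a)) p = sat A M (e(n := a)) p" if "a \<in> N" for a
      by (rule Ex.IH) (use that Ex.prems in auto)
    have "\<exists>a\<in>N. sat A M (e(n := a)) p" if a: "a \<in> A" "sat A M (e(n := a)) p" for a
    proof -
      \<comment> \<open>The first \<open>m\<close> values of the environment cover every variable of
        \<open>p\<close>, so a finite list of parameters suffices.\<close>
      obtain m where m: "\<And>i. i \<in> fm_vars p \<Longrightarrow> i < m"
        using finite_nat_set_iff_bounded[THEN iffD1, OF finite_fm_vars[of p]] by auto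
      let ?xs = "map e [0..<m]"
      let ?Q = "\<lambda>a. a \<in> A \<and> sat A M (((!) ?xs)(n := a)) p"
      have eq: "sat A M (((!) ?xs)(n := b)) p = sat A M (e(n := b)) p" for b
        by (rule sat_cong) (use m in auto)
      have ex: "\<exists>b. ?Q b" using a eq by blast
      have "(SOME b. ?Q b) \<in> skolem_ops A M ?xs"
        unfolding skolem_ops_def using ex by (intro UnI2 image_eqI[of _ _ "(p, n)"]) auto
      moreover have "set ?xs \<subseteq> N" using Ex.prems by auto
      ultimately have "(SOME b. ?Q b) \<in> N" using N(1) unfolding closed_under_def by blast
      moreover have "sat A M (e(n := (SOME b. ?Q b))) p" using someI_ex[OF ex] eq by simp
      ultimately show ?thesis by blast
    qed
    then show ?case using IH N(2) by auto
  qed auto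
  moreover have "algebra_on N M"
    using N(1) unfolding algebra_on_def closed_under_def skolem_ops_def by blast
  ultimately show ?thesis using N(2,3) unfolding elementary_sub_def by blast
qed

section \<open>A continuous chain of small hulls\<close>

text \<open>Each stage receives all earlier stages, their suprema and the successors of these. The
  successors make the suprema strictly increasing, since \<open>osup\<close> itself is not a strict
  bound.\<close>

function chain :: "('v list \<Rightarrow> 'v set) \<Rightarrow> 'v::zfc set \<Rightarrow> 'v set \<Rightarrow> 'v \<Rightarrow> 'v set" where
  "chain ops X K a = hull_under ops (X \<union> (\<Union>b\<in>elts a. chain ops X K b \<union>
     (\<Union>k\<in>K. {osup (chain ops X K b \<inter> elts k), osucc (osup (chain ops X K b \<inter> elts k))})))"
  by auto
termination
  by (relation "inv_image {(x, y). x \<in> elts y} (\<lambda>(ops, X, K, a). a)")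
    (auto intro: wf_inv_image zfc_foundation)

declare chain.simps [simp del]

text \<open>Each stage has size at most \<open>m\<close>, so regularity of every \<open>k\<close>
  above \<open>m\<close> keeps its supremum inside \<open>k\<close>. At a limit, the union of the
  earlier stages is already closed and contains all generators, so it is the hull.\<close>

lemma chain_exists:
  fixes m :: "'v::zfc"
  assumes m: "regular_card m"
    and K: "\<And>k. k \<in> K \<Longrightarrow> regular_card k" "\<And>k. k \<in> K \<Longrightarrow> m \<in> elts k"
      "K \<noteq> {}" "K \<lesssim> elts m"
    and ops: "\<And>xs. countable (ops xs)"
    and A: "closed_under ops A" "K \<subseteq> A" "\<And>k. k \<in> K \<Longrightarrow> elts k \<subseteq> A"
  obtains N where
    "\<And>a. closed_under ops (N a)" "\<And>a. K \<subseteq> N a" "\<And>a. m \<in> N a"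
    "\<And>a. a \<in> elts (osucc m) \<Longrightarrow> N a \<subseteq> A"
    "\<And>a k. \<lbrakk>a \<in> elts (osucc m); k \<in> K\<rbrakk> \<Longrightarrow> osup (N a \<inter> elts k) \<in> elts k"
    "\<And>a b. b \<in> elts a \<Longrightarrow> N b \<subseteq> N a"
    "\<And>a b k. \<lbrakk>b \<in> elts a; k \<in> K\<rbrakk> \<Longrightarrow>
      osup (N b \<inter> elts k) \<in> N a \<and> osucc (osup (N b \<inter> elts k)) \<in> N a"
    "\<And>a. Limit a \<Longrightarrow> N a = (\<Union>b\<in>elts a. N b)"
proof -
  define N where "N = chain ops (insert m K) K"
  define gen where "gen b = N b \<union>
    (\<Union>k\<in>K. {osup (N b \<inter> elts k), osucc (osup (N b \<inter> elts k))})" for b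
  have N: "N a = hull_under ops (insert m K \<union> (\<Union>b\<in>elts a. gen b))" for a
    unfolding gen_def N_def by (rule chain.simps)
  have sub: "insert m K \<union> (\<Union>b\<in>elts a. gen b) \<subseteq> N a" for a
    unfolding N[of a] by (rule subset_hull_under)
  have closed: "closed_under ops (N a)" for a
    unfolding N[of a] by (rule closed_hull_under)
  have mono: "N b \<subseteq> N a" if "b \<in> elts a" for a b using sub[of a] that unfolding gen_def by blast
  have lm: "Limit m" by (rule regular_card_Limit[OF m])
  have om: "Ord m" by (rule Limit_Ord[OF lm])
  have im: "infinite (elts m)" by (rule infinite_Limit[OF lm])
  \<comment> \<open>The three claims need one joint induction: smallness bounds the suprema below
    \<open>k\<close>, and this keeps the generators of later stages inside \<open>A\<close>.\<close>
  have main: "N a \<lesssim> elts m \<and> N a \<subseteq> A \<and> (\<forall>k\<in>K. osup (N a \<inter> elts k) \<in> elts k)"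
    if "a \<in> elts (osucc m)" for a
    using that
  proof (induction a rule: mem_induct)
    case (step a)
    have am: "elts a \<subseteq> elts m" using step.prems Ord_subset[OF om] by (auto simp: elts_osucc[OF om])
    have b: "b \<in> elts (osucc m)" if "b \<in> elts a" for b using am that by (auto simp: elts_osucc[OF om])
    note IH = step.IH[OF _ b]
    have limk: "Limit k" if "k \<in> K" for k using regular_card_Limit[OF K(1)[OF that]] .
    have gA: "gen b \<subseteq> A" if "b \<in> elts a" for b
    proof -
      have "osup (N b \<inter> elts k) \<in> A \<and> osucc (osup (N b \<inter> elts k)) \<in> A" if "k \<in> K" for k
        using IH[OF \<open>b \<in> elts a\<close> \<open>b \<in> elts a\<close>] that A(3)[OF that] limk[OF that]
        unfolding Limit_def by blast
      then show ?thesis unfolding gen_def using IH[OF that that] by blast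
    qed
    have gs: "gen b \<lesssim> elts m" if "b \<in> elts a" for b
      unfolding gen_def
      by (rule Un_lepoll_infinite[OF im], use IH[OF that that] in blast,
        intro UN_lepoll_infinite[OF im K(4)] finite_lepoll_infinite[OF im]) simp_all
    have "insert m K \<subseteq> A" using A(2,3) K(2,3) by blast
    then have NA: "N a \<subseteq> A"
      unfolding N[of a] using gA by (intro hull_under_minimal A(1)) blast
    have "insert m K \<lesssim> elts m"
      using Un_lepoll_infinite[OF im finite_lepoll_infinite[OF im, of "{m}"] K(4)] by simp
    then have Ns: "N a \<lesssim> elts m"
      unfolding N[of a]
      by (intro hull_under_lepoll[OF im] ops Un_lepoll_infinite[OF im]
          UN_lepoll_infinite[OF im subset_imp_lepoll[OF am]] gs)
    have "osup (N a \<inter> elts k) \<in> elts k" if k: "k \<in> K" for k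
    proof -
      have ok: "Ord k" by (rule Limit_Ord[OF limk[OF k]])
      have "N a \<inter> elts k \<lesssim> elts m" using lepoll_trans[OF subset_imp_lepoll Ns] by blast
      then obtain u where u: "u \<in> elts k" "\<forall>y\<in>N a \<inter> elts k. y \<in> elts u"
        using regular_bounded[OF K(1)[OF k] K(2)[OF k], of "N a \<inter> elts k"] by blast
      have ou: "Ord u" by (rule Ord_in[OF ok u(1)])
      have "Ord (osup (N a \<inter> elts k))" "elts (osup (N a \<inter> elts k)) = \<Union> (elts ` (N a \<inter> elts k))"
        using osup[of "N a \<inter> elts k" k] Ord_in[OF ok] by blast+
      moreover from this have "elts (osup (N a \<inter> elts k)) \<subseteq> elts u"
        using u(2) Ord_subset[OF ou] by blast
      ultimately show ?thesis using Ord_mem_subset_trans[OF _ ou _ u(1) ok] by blast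
    qed
    then show ?case using NA Ns by blast
  qed
  have lim: "N a = (\<Union>b\<in>elts a. N b)" if a: "Limit a" for a
  proof
    have oa: "Ord a" by (rule Limit_Ord[OF a])
    have "closed_under ops (\<Union> (N ` elts a))"
    proof (rule closed_under_directed_Union)
      show "N ` elts a \<noteq> {}" using a unfolding Limit_def by blast
      fix Y Z assume "Y \<in> N ` elts a" "Z \<in> N ` elts a"
      then obtain b c where bc: "b \<in> elts a" "c \<in> elts a" "Y = N b" "Z = N c" by blast
      then have "b \<in> elts c \<or> b = c \<or> c \<in> elts b" using Ord_linear[OF Ord_in Ord_in, OF oa _ oa] by blast
      then have "Y \<union> Z \<subseteq> N c \<or> Y \<union> Z \<subseteq> N b" using mono bc(3,4) by blast
      then show "\<exists>W\<in>N ` elts a. Y \<union> Z \<subseteq> W" using bc(1,2) by blast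
    qed (use closed in blast)
    moreover have "insert m K \<union> (\<Union>b\<in>elts a. gen b) \<subseteq> \<Union> (N ` elts a)"
    proof -
      \<comment> \<open>The generators from stage \<open>b\<close> are absorbed by any stage
        strictly between \<open>b\<close> and the limit.\<close>
      have "gen b \<subseteq> \<Union> (N ` elts a)" if "b \<in> elts a" for b
      proof -
        obtain c where "c \<in> elts a" "b \<in> elts c" using Limit_above[OF a \<open>b \<in> elts a\<close>] by blast
        then show ?thesis using sub[of c] by blast
      qed
      moreover have "insert m K \<subseteq> \<Union> (N ` elts a)"
        using a sub unfolding Limit_def by blast
      ultimately show ?thesis by blast
    qed
    ultimately show "N a \<subseteq> (\<Union>b\<in>elts a. N b)"
      unfolding N[of a] by (intro hull_under_minimal) auto
    show "(\<Union>b\<in>elts a. N b) \<subseteq> N a" using mono by blast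
  qed
  have sup: "osup (N b \<inter> elts k) \<in> N a \<and> osucc (osup (N b \<inter> elts k)) \<in> N a"
    if "b \<in> elts a" "k \<in> K" for a b k
    using sub[of a] that unfolding gen_def by blast
  show ?thesis
  proof (rule that[OF closed _ _ _ _ mono sup lim])
    show "K \<subseteq> N a" "m \<in> N a" for a using sub[of a] by auto
    show "N a \<subseteq> A" if "a \<in> elts (osucc m)" for a using main[OF that] by simp
    show "osup (N a \<inter> elts k) \<in> elts k" if "a \<in> elts (osucc m)" "k \<in> K" for a k
      using main[OF that(1)] that(2) by simp
  qed
qed

section \<open>Thinning out continuous sequences\<close>

text \<open>Coherence makes \<open>C\<^sub>\<beta>\<close> an initial segment of \<open>C\<^sub>\<gamma>\<close> for every limit point \<open>\<beta>\<close> of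
  \<open>C\<^sub>\<gamma>\<close>, so distinct limit points have distinct order types.\<close>

lemma square_otp_distinct:
  assumes C: "square_seq g C" and \<gamma>: "\<gamma> \<in> Sing g" "Ord \<gamma>"
    and b: "b \<in> elts \<gamma>" "limit_point b (C \<gamma>)"
    and c: "c \<in> elts \<gamma>" "limit_point c (C \<gamma>)" and bc: "b \<in> elts c"
  shows "otp (C b) \<noteq> otp (C c)"
proof -
  have Cb: "C b = C \<gamma> \<inter> elts b" and Cc: "C c = C \<gamma> \<inter> elts c"
    using C \<gamma>(1) b c unfolding square_seq_def by blast+
  have "b \<in> C \<gamma>" using C \<gamma>(1) b unfolding square_seq_def club_def by blast
  moreover have oc: "Ord c" by (rule Ord_in[OF \<gamma>(2) c(1)])
  ultimately show ?thesis
    using Ord_subset[OF oc bc] bc unfolding Cb Cc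
    by (intro otp_initial_segment[of _ c _ b]) auto
qed

text \<open>Here \<open>s k a\<close> stands for the supremum of the stage \<open>a\<close> in
  \<open>k\<close>. The function \<open>d\<close> is an increasing continuous enumeration of stages
  that are good for all \<open>k\<close> at once; its top value may be \<open>m\<close>
  itself.\<close>

lemma thin_out:
  fixes m t g :: "'v::zfc" and s :: "'v \<Rightarrow> 'v \<Rightarrow> 'v"
  assumes m: "regular_card m" "omega \<in> elts m"
    and K: "K \<lesssim> elts t" "t \<in> elts m"
    and os: "\<And>k. k \<in> K \<Longrightarrow> Ord (s k m)"
    and mono: "\<And>k a b. \<lbrakk>k \<in> K; a \<in> elts (osucc m); b \<in> elts a\<rbrakk> \<Longrightarrow> s k b \<in> elts (s k a)"
    and cont: "\<And>k a x. \<lbrakk>k \<in> K; a \<in> elts (osucc m); Limit a; x \<in> elts (s k a)\<rbrakk>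
      \<Longrightarrow> \<exists>b\<in>elts a. x \<in> elts (s k b)"
    and ms: "\<And>k. k \<in> K \<Longrightarrow> m \<in> elts (s k m)"
    and C: "square_seq g C" and sg: "\<And>k. k \<in> K \<Longrightarrow> s k m \<in> elts g"
    and S': "\<And>k b. \<lbrakk>k \<in> K; b \<in> S' k\<rbrakk> \<Longrightarrow> cf b = omega"
      "\<And>k b c. \<lbrakk>k \<in> K; b \<in> S' k; c \<in> S' k\<rbrakk> \<Longrightarrow> otp (C b) = otp (C c)"
  obtains d where
    "\<And>a. a \<in> elts (osucc m) \<Longrightarrow> d a \<in> elts (osucc m) \<and> Limit (d a)"
    "\<And>a b. \<lbrakk>a \<in> elts (osucc m); b \<in> elts a\<rbrakk> \<Longrightarrow> d b \<in> elts (d a)"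
    "\<And>a x. \<lbrakk>a \<in> elts (osucc m); Limit a; x \<in> elts (d a)\<rbrakk> \<Longrightarrow> \<exists>b\<in>elts a. x \<in> elts (d b)"
    "\<And>a k. \<lbrakk>a \<in> elts (osucc m); k \<in> K\<rbrakk> \<Longrightarrow> s k (d a) \<notin> S' k"
proof -
  have lm: "Limit m" by (rule regular_card_Limit[OF m(1)])
  have om: "Ord m" by (rule Limit_Ord[OF lm])
  have em: "elts (osucc m) = insert m (elts m)" by (rule elts_osucc[OF om])
  have mem: "b \<in> elts (osucc m)" if "a \<in> elts (osucc m)" "b \<in> elts a" for a b
    using that Ord_trans[OF om] unfolding em by blast
  have oss: "Ord (s k a)" if "k \<in> K" "a \<in> elts (osucc m)" for k a
    using that os[OF that(1)] Ord_in[OF os mono, OF that(1) that(1)] unfolding em by auto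
  have mono_m: "s k b \<in> elts (s k m)" if "k \<in> K" "b \<in> elts m" for k b
    using mono[OF that(1) _ that(2)] unfolding em by blast
  have cont_m: "\<exists>b\<in>elts m. x \<in> elts (s k b)" if "k \<in> K" "x \<in> elts (s k m)" for k x
    using cont[OF that(1) _ lm that(2)] unfolding em by blast

  \<comment> \<open>Cofinality and singularity of the top ordinals\<close>
  have cf_le: "elts (cf (s k m)) \<subseteq> elts m" if k: "k \<in> K" for k
  proof (rule cf(4)[OF os[OF k] om])
    show "cofinal_map (s k) m (s k m)"
      unfolding cofinal_map_def
    proof (intro conjI ballI)
      show "s k ` elts m \<subseteq> elts (s k m)" using mono_m[OF k] by blast
      fix x assume "x \<in> elts (s k m)"
      then obtain b where b: "b \<in> elts m" "x \<in> elts (s k b)" using cont_m[OF k] by blast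
      then have "elts x \<subseteq> elts (s k b)"
        using Ord_subset[OF oss[OF k]] unfolding em by blast
      then show "\<exists>b\<in>elts m. elts x \<subseteq> elts (s k b)" using b by blast
    qed
  qed
  \<comment> \<open>The top ordinal has cofinality at most \<open>m\<close> and lies above
    \<open>m\<close>, so it is singular and the square sequence is defined there.\<close>
  have sing: "s k m \<in> Sing g" if k: "k \<in> K" for k
  proof -
    have "Limit (s k m)"
    proof (rule LimitI[OF os[OF k]])
      show "elts (s k m) \<noteq> {}" using ms[OF k] by blast
      show "\<exists>y\<in>elts (s k m). x \<in> elts y" if "x \<in> elts (s k m)" for x
        using cont_m[OF k that] mono_m[OF k] by blast
    qed
    moreover have "cf (s k m) \<in> elts (s k m)"
      by (rule Ord_mem_subset_trans[OF cf(1)[OF os[OF k]] om cf_le[OF k] ms[OF k] os[OF k]])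
    ultimately show ?thesis using sg[OF k] unfolding Sing_def by blast
  qed
  \<comment> \<open>Choose for each value of a cofinal \<omega>-sequence a stage below
    \<open>m\<close> exceeding it. Since \<open>m\<close> is regular and uncountable, some
    \<open>u\<close> below \<open>m\<close> bounds these stages, and then \<open>s k u\<close>
    bounds the whole sequence.\<close>
  have top: "s k m \<notin> S' k" if k: "k \<in> K" for k
  proof
    assume "s k m \<in> S' k"
    then have "cf (s k m) = omega" by (rule S'(1)[OF k])
    then obtain f where f: "cofinal_map f omega (s k m)" using cf(2)[OF os[OF k]] by auto
    have "\<forall>y\<in>elts omega. \<exists>b\<in>elts m. f y \<in> elts (s k b)"
      using f cont_m[OF k] unfolding cofinal_map_def by blast
    then obtain h where h: "\<And>y. y \<in> elts omega \<Longrightarrow> h y \<in> elts m \<and> f y \<in> elts (s k (h y))" by metis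
    obtain u where u: "u \<in> elts m" "\<forall>y\<in>h ` elts omega. y \<in> elts u"
      using regular_bounded[OF m(1,2), of "h ` elts omega"] h image_lepoll[of h "elts omega"] by auto
    obtain y where y: "y \<in> elts omega" "elts (s k u) \<subseteq> elts (f y)"
      using f mono_m[OF k u(1)] unfolding cofinal_map_def by blast
    have uo: "u \<in> elts (osucc m)" using u(1) em by blast
    have "s k (h y) \<in> elts (s k u)" using mono[OF k uo] u(2) y(1) by blast
    then have "f y \<in> elts (s k u)"
      using Ord_trans[OF oss[OF k uo]] h[OF y(1)] by blast
    then show False using y(2) mem_irrefl by blast
  qed

  \<comment> \<open>Closure points and limit points of the square sequence\<close>
  define Q where "Q a b \<longleftrightarrow> (\<forall>k\<in>K. \<exists>y\<in>C (s k m). s k a \<in> elts y \<and> y \<in> elts (s k b))" for a b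
  \<comment> \<open>At such a stage \<open>x\<close> below \<open>m\<close>, points of each
    \<open>C (s k m)\<close> interleave with the values of \<open>s k\<close>, so
    \<open>s k x\<close> is a limit point of \<open>C (s k m)\<close>.\<close>
  define clp where "clp x \<longleftrightarrow> Limit x \<and>
    (\<forall>b\<in>elts x. \<exists>c\<in>elts x. \<exists>d\<in>elts x. b \<in> elts c \<and> c \<in> elts d \<and> Q c d)" for x
  have clubC: "club (C (s k m)) (s k m)" if "k \<in> K" for k
    using C sing[OF that] unfolding square_seq_def by blast
  have max2: "\<exists>b\<in>elts m. u \<in> elts b \<and> a \<in> elts b" if ua: "u \<in> elts m" "a \<in> elts m" for u a
  proof -
    obtain v w where v: "v \<in> elts m" "u \<in> elts v" and w: "w \<in> elts m" "a \<in> elts w"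
      using Limit_above[OF lm ua(1)] Limit_above[OF lm ua(2)] by blast
    have ov: "Ord v" and ow: "Ord w" using Ord_in[OF om] v(1) w(1) by auto
    consider "elts v \<subseteq> elts w" | "elts w \<subseteq> elts v"
      using Ord_not_mem[OF ow ov] Ord_subset[OF ov, of w] by metis
    then show ?thesis using v w by (cases; blast)
  qed
  \<comment> \<open>\<open>K\<close> has size at most \<open>t\<close>, which is below the regular
    \<open>m\<close>; hence choices made separately for each \<open>k\<close> have a common
    bound.\<close>
  have bddK: "\<exists>u\<in>elts m. \<forall>k\<in>K. b k \<in> elts u" if "\<And>k. k \<in> K \<Longrightarrow> b k \<in> elts m" for b
    using regular_bounded[OF m(1) K(2), of "b ` K"] lepoll_trans[OF image_lepoll K(1), of b] that
    by auto
  have Qstep: "\<exists>b\<in>elts m. a \<in> elts b \<and> Q a b" if a: "a \<in> elts m" for a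
  proof -
    have "\<forall>k\<in>K. \<exists>b\<in>elts m. \<exists>y\<in>C (s k m). s k a \<in> elts y \<and> y \<in> elts (s k b)"
    proof
      fix k assume k: "k \<in> K"
      obtain y where "y \<in> C (s k m)" "s k a \<in> elts y"
        using clubC[OF k] mono_m[OF k a] unfolding club_def by blast
      moreover from this obtain b where "b \<in> elts m" "y \<in> elts (s k b)"
        using clubC[OF k] cont_m[OF k] unfolding club_def by blast
      ultimately show "\<exists>b\<in>elts m. \<exists>y\<in>C (s k m). s k a \<in> elts y \<and> y \<in> elts (s k b)" by blast
    qed
    then obtain b where b: "\<And>k. k \<in> K \<Longrightarrow> b k \<in> elts m \<and>
      (\<exists>y\<in>C (s k m). s k a \<in> elts y \<and> y \<in> elts (s k (b k)))" by metis
    obtain u where u: "u \<in> elts m" "\<forall>k\<in>K. b k \<in> elts u" using bddK[of b] b by blast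
    obtain v where v: "v \<in> elts m" "u \<in> elts v" "a \<in> elts v" using max2[OF u(1) a] by blast
    have vo: "v \<in> elts (osucc m)" using v(1) em by blast
    have "\<exists>y\<in>C (s k m). s k a \<in> elts y \<and> y \<in> elts (s k v)" if k: "k \<in> K" for k
    proof -
      obtain y where y: "y \<in> C (s k m)" "s k a \<in> elts y" "y \<in> elts (s k (b k))" using b[OF k] by blast
      have "b k \<in> elts v" using Ord_trans[OF Ord_in[OF om v(1)] v(2)] u(2) k by blast
      then have "y \<in> elts (s k v)" using Ord_trans[OF oss[OF k vo] mono[OF k vo]] y(3) by blast
      then show ?thesis using y by blast
    qed
    then show ?thesis using v unfolding Q_def by blast
  qed
  have clp_m: "clp m" unfolding clp_def using lm Qstep Limit_above[OF lm] by metis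
  have lp: "limit_point (s k x) (C (s k m))" if x: "x \<in> elts m" "clp x" and k: "k \<in> K" for k x
  proof -
    have xo: "x \<in> elts (osucc m)" using x(1) em by blast
    have lx: "Limit x" using x(2) unfolding clp_def by blast
    have osx: "Ord (s k x)" by (rule oss[OF k xo])
    have unb: "\<exists>y\<in>C (s k m) \<inter> elts (s k x). z \<in> elts y" if z: "z \<in> elts (s k x)" for z
    proof -
      obtain b where b: "b \<in> elts x" "z \<in> elts (s k b)" using cont[OF k xo lx z] by blast
      obtain c d where cd: "c \<in> elts x" "d \<in> elts x" "b \<in> elts c" "Q c d"
        using x(2) b(1) unfolding clp_def by blast
      obtain y where y: "y \<in> C (s k m)" "s k c \<in> elts y" "y \<in> elts (s k d)"
        using cd(4) k unfolding Q_def by blast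
      have "y \<in> elts (s k x)" using Ord_trans[OF osx mono[OF k xo cd(2)] y(3)] .
      moreover have "z \<in> elts y"
        using Ord_trans[OF Ord_in[OF osx calculation] y(2)]
          Ord_trans[OF oss[OF k mem[OF xo cd(1)]] mono[OF k mem[OF xo cd(1)] cd(3)] b(2)] by blast
      ultimately show ?thesis using y(1) by blast
    qed
    have "Limit (s k x)"
    proof (rule LimitI[OF osx])
      show "elts (s k x) \<noteq> {}" using lx mono[OF k xo] unfolding Limit_def by blast
      show "\<exists>y\<in>elts (s k x). z \<in> elts y" if "z \<in> elts (s k x)" for z using unb[OF that] by blast
    qed
    then show ?thesis unfolding limit_point_def using unb by blast
  qed
  \<comment> \<open>By distinctness of order types at most one closure point is bad for
    \<open>k\<close>. Take \<open>e\<close> to be that stage if there is one, and otherwise an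
    arbitrary element of \<open>m\<close>.\<close>
  have "\<exists>e\<in>elts m. \<forall>x\<in>elts m. clp x \<longrightarrow> e \<in> elts x \<longrightarrow> s k x \<notin> S' k" if k: "k \<in> K" for k
  proof (cases "\<exists>x\<in>elts m. clp x \<and> s k x \<in> S' k")
    case True
    then obtain e where e: "e \<in> elts m" "clp e" "s k e \<in> S' k" by blast
    have "s k x \<notin> S' k" if x: "x \<in> elts m" "clp x" "e \<in> elts x" for x
    proof
      assume "s k x \<in> S' k"
      then have "otp (C (s k e)) = otp (C (s k x))" using S'(2)[OF k e(3)] by blast
      moreover have "s k e \<in> elts (s k x)" using mono[OF k _ x(3)] x(1) unfolding em by blast
      ultimately show False
        using square_otp_distinct[OF C sing[OF k] os[OF k] mono_m[OF k e(1)] lp[OF e(1,2) k]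
            mono_m[OF k x(1)] lp[OF x(1,2) k]] by blast
    qed
    then show ?thesis using e(1) by blast
  next
    case False
    then show ?thesis using K(2) by blast
  qed
  then obtain e where e: "\<And>k. k \<in> K \<Longrightarrow> e k \<in> elts m \<and>
    (\<forall>x\<in>elts m. clp x \<longrightarrow> e k \<in> elts x \<longrightarrow> s k x \<notin> S' k)" by metis
  \<comment> \<open>Beyond \<open>E\<close> the exceptional stages of all \<open>k\<close> have been
    passed.\<close>
  obtain E where E: "E \<in> elts m" "\<forall>k\<in>K. e k \<in> elts E" using bddK[of e] e by blast
  define good where "good x \<longleftrightarrow> clp x \<and> E \<in> elts x" for x
  have good: "s k x \<notin> S' k" if x: "x \<in> elts (osucc m)" "good x" and k: "k \<in> K" for x k
  proof (cases "x = m")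
    case True
    then show ?thesis using top[OF k] by simp
  next
    case False
    then have xm: "x \<in> elts m" using x(1) em by blast
    have "e k \<in> elts x"
      using Ord_trans[OF Ord_in[OF om xm]] E(2) x(2) k unfolding good_def by blast
    then show ?thesis using e[OF k] xm x(2) unfolding good_def by blast
  qed

  \<comment> \<open>Increasing continuous enumeration of the good stages\<close>
  define d where "d = wfrec {(x, y :: 'v). x \<in> elts y}
    (\<lambda>f a. least_ord (\<lambda>x. good x \<and> (\<forall>b\<in>elts a. f b \<in> elts x)))"
  define P where "P a x \<longleftrightarrow> good x \<and> (\<forall>b\<in>elts a. d b \<in> elts x)" for a x
  have d: "d a = least_ord (P a)" for a
    unfolding P_def d_def
    by (subst wfrec[OF zfc_foundation]) (simp add: cut_def)
  \<comment> \<open>The stage \<open>m\<close> is always a candidate, so the least one exists. For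
    \<open>a\<close> below \<open>m\<close>, regularity bounds the earlier values, and a closure
    point above that bound and \<open>E\<close> keeps \<open>d a\<close> below
    \<open>m\<close>.\<close>
  have dP: "(d a \<in> elts (osucc m) \<and> P a (d a) \<and> (\<forall>x. Ord x \<longrightarrow> P a x \<longrightarrow> elts (d a) \<subseteq> elts x)) \<and>
    (a \<in> elts m \<longrightarrow> d a \<in> elts m)" if "a \<in> elts (osucc m)" for a
    using that
  proof (induction a rule: mem_induct)
    case (step a)
    have am: "elts a \<subseteq> elts m" using step.prems Ord_subset[OF om, of a] unfolding em by blast
    have dm: "d b \<in> elts m" if "b \<in> elts a" for b
      using step.IH[OF that mem[OF step.prems that]] am that by blast
    have "P a m" unfolding P_def good_def using clp_m E(1) dm by blast
    note l = least_ord[where P = "P a", OF om this, folded d]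
    have dm': "d a \<in> elts (osucc m)"
      using Ord_subset_cases[OF l(1) om l(4)[OF om \<open>P a m\<close>]] em by blast
    have "d a \<in> elts m" if a: "a \<in> elts m"
    proof -
      obtain u where u: "u \<in> elts m" "\<forall>y\<in>d ` elts a. y \<in> elts u"
        using regular_bounded[OF m(1) a, of "d ` elts a"] dm image_lepoll[of d "elts a"] by auto
      obtain v where v: "v \<in> elts m" "u \<in> elts v" "E \<in> elts v" using max2[OF u(1) E(1)] by blast
      obtain x where x: "x \<in> elts m" "Limit x" "v \<in> elts x"
        "\<And>b. b \<in> elts x \<Longrightarrow> \<exists>c\<in>elts x. \<exists>d\<in>elts x. b \<in> elts c \<and> c \<in> elts d \<and> Q c d"
        using closure_point[OF m, of Q, OF Qstep v(1)] by metis
      have ox: "Ord x" by (rule Limit_Ord[OF x(2)])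
      have "clp x" unfolding clp_def using x(2,4) by blast
      moreover have "E \<in> elts x" by (rule Ord_trans[OF ox x(3) v(3)])
      moreover have "d b \<in> elts x" if "b \<in> elts a" for b
        using Ord_trans[OF ox Ord_trans[OF ox x(3) v(2)]] u(2) that by blast
      ultimately have "P a x" unfolding P_def good_def by blast
      then show ?thesis using Ord_mem_subset_trans[OF l(1) ox l(4)[OF ox] x(1) om] by blast
    qed
    then show ?case using dm' l(2) l(4) by blast
  qed
  show ?thesis
  proof (rule that)
    fix a assume a: "a \<in> elts (osucc m)"
    show "d a \<in> elts (osucc m) \<and> Limit (d a)"
      using dP[OF a] unfolding P_def good_def clp_def by blast
    show "d b \<in> elts (d a)" if "b \<in> elts a" for b using dP[OF a] that unfolding P_def by blast
    show "s k (d a) \<notin> S' k" if "k \<in> K" for k using good[OF _ _ that] dP[OF a] unfolding P_def by blast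
    \<comment> \<open>The union of the earlier values is itself good, so by minimality
      \<open>d a\<close> does not exceed it.\<close>
    show "\<exists>b\<in>elts a. x \<in> elts (d b)" if La: "Limit a" and x: "x \<in> elts (d a)" for x
    proof -
      have od: "Ord y" if "y \<in> d ` elts a" for y
        using that dP mem[OF a] Ord_in[OF Ord_osucc[OF om]] by blast
      have "d ` elts a \<subseteq> elts (osucc m)" using dP mem[OF a] by blast
      then obtain u where u: "Ord u" "elts u = \<Union> (elts ` d ` elts a)"
        using Union_Ord[of "d ` elts a" "osucc m"] od by blast
      have g: "P b (d b)" if "b \<in> elts a" for b using dP[OF mem[OF a that]] by blast
      have du: "d b \<in> elts u" if b: "b \<in> elts a" for b
      proof -
        obtain c where "c \<in> elts a" "b \<in> elts c" using Limit_above[OF La b] by blast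
        then show ?thesis using g[of c] u(2) unfolding P_def by blast
      qed
      obtain b0 where b0: "b0 \<in> elts a" using La unfolding Limit_def by blast
      have "Limit u"
      proof (rule LimitI[OF u(1)])
        show "elts u \<noteq> {}" using du[OF b0] by blast
        show "\<exists>y\<in>elts u. z \<in> elts y" if "z \<in> elts u" for z using that u(2) du by blast
      qed
      moreover have "\<exists>c\<in>elts u. \<exists>e\<in>elts u. b \<in> elts c \<and> c \<in> elts e \<and> Q c e" if b: "b \<in> elts u" for b
      proof -
        obtain b' where b': "b' \<in> elts a" "b \<in> elts (d b')" using b u(2) by blast
        then obtain c e where "c \<in> elts (d b')" "e \<in> elts (d b')" "b \<in> elts c" "c \<in> elts e" "Q c e"
          using g[OF b'(1)] unfolding P_def good_def clp_def by blast
        then show ?thesis using b'(1) u(2) by blast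
      qed
      moreover have "E \<in> elts u" using g[OF b0] b0 u(2) unfolding P_def good_def by blast
      ultimately have "P a u" using du unfolding P_def good_def clp_def by blast
      then have "elts (d a) \<subseteq> elts u" using dP[OF a] u(1) by blast
      then show ?thesis using x u(2) by blast
    qed
  qed
qed

section \<open>Mutual fatness\<close>

text \<open>The transitive closure of an ordinal is the ordinal itself, so membership in
  \<open>H c\<close> is a matter of its size.\<close>

lemma Ord_in_H:
  fixes c q x :: "'v::zfc"
  assumes "Card c" "q \<in> elts c" "Ord x" "elts x \<subseteq> elts q"
  shows "x \<in> H c"
proof -
  have "y \<in> elts x" if "(y, x) \<in> {(u, w). u \<in> elts w}\<^sup>+" for y
    using that
  proof (induction rule: converse_trancl_induct)
    case (step y z)
    then show ?case using Ord_trans[OF assms(3), of z y] by simp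
  qed simp
  then have "{y. (y, x) \<in> {(u, w). u \<in> elts w}\<^sup>+} \<subseteq> elts q" using assms(4) by blast
  moreover have "elts q \<prec> elts c" using assms(1,2) unfolding Card_def by simp
  ultimately have "{y. (y, x) \<in> {(u, w). u \<in> elts w}\<^sup>+} \<prec> elts c"
    using lesspoll_trans1[OF subset_imp_lepoll] by metis
  then show ?thesis unfolding H_def by (rule CollectI)
qed

theorem mainTheorem8:
  fixes \<theta> \<psi> :: "'v::zfc"
    and \<kappa> :: "'v \<Rightarrow> 'v"
    and K :: "'v set"
    and C S :: "'v \<Rightarrow> 'v set"
  assumes "Ord \<theta>" and "\<theta> \<noteq> ozero"
    and "K = \<kappa> ` elts \<theta>"
    and "\<And>\<xi> \<eta>. \<eta> \<in> elts \<theta> \<Longrightarrow> \<xi> \<in> elts \<eta> \<Longrightarrow> \<kappa> \<xi> \<in> elts (\<kappa> \<eta>)"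
    and "\<And>k. k \<in> K \<Longrightarrow> regular_card k \<and> omega \<in> elts k"
    and "csucc \<theta> \<in> elts (\<kappa> ozero)"
    and "\<not> (\<exists>\<mu>. singular_card \<mu> \<and> \<kappa> ozero = csucc \<mu>)"
    and "InfCard \<psi>" and "csucc (csucc \<psi>) \<in> elts (\<kappa> ozero)" and "GCH_from \<psi>"
    and "square_seq (osucc (osup K)) C"
    and "\<And>k. k \<in> K \<Longrightarrow> S k \<subseteq> E_omega k \<and> stationary (S k) k"
  shows "\<exists>S'. (\<forall>k\<in>K. S' k \<subseteq> S k \<and> stationary (S' k) k) \<and>
           strongly_mutually_fat K (\<lambda>k. elts k - S' k)"
proof -

  \<comment> \<open>The supremum and the least element of \<open>K\<close>\<close>
  have regK: "regular_card k" "omega \<in> elts k" "Limit k" "Ord k" if "k \<in> K" for k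
    using assms(5)[OF that] regular_card_Limit Limit_Ord by auto
  obtain x where x: "elts x = K" using zfc_replacement[of \<kappa> \<theta>] assms(3) by auto
  define q where "q = osup K"
  have oq: "Ord q" and eq: "elts q = \<Union> (elts ` K)"
    using osup[of K x] x regK(4) unfolding q_def by auto
  have eg: "elts (osucc q) = insert q (elts q)" by (rule elts_osucc[OF oq])
  have sq: "square_seq (osucc q) C" using assms(11) unfolding q_def .
  have kq: "y \<in> elts (osucc q)" if "k \<in> K" "y \<in> elts k" for k y using that eq eg by blast

  have oz: "ozero \<in> elts \<theta>"
  proof -
    have "Ord (ozero :: 'v)" by (rule OrdI) auto
    then show ?thesis using Ord_linear[OF assms(1)] assms(2) by fastforce
  qed
  define k0 where "k0 = \<kappa> ozero"
  have k0: "k0 \<in> K" using oz assms(3) unfolding k0_def by blast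
  have minK: "elts k0 \<subseteq> elts k" if k: "k \<in> K" for k
  proof -
    obtain \<xi> where \<xi>: "\<xi> \<in> elts \<theta>" "k = \<kappa> \<xi>" using k assms(3) by blast
    have "Ord \<xi>" "Ord (ozero :: 'v)" using Ord_in[OF assms(1)] \<xi>(1) oz by auto
    then have "\<xi> = ozero \<or> ozero \<in> elts \<xi>" using Ord_linear[of \<xi> ozero] by auto
    then show ?thesis
      using assms(4)[OF \<xi>(1), of ozero] \<xi>(2) Ord_subset[OF regK(4)[OF k], of k0]
      unfolding k0_def by auto
  qed

  \<comment> \<open>Stationary subsets with constant order type\<close>
  have S: "S k \<subseteq> E_omega k" "stationary (S k) k" if "k \<in> K" for k using assms(12)[OF that] by auto
  \<comment> \<open>Cofinality \<omega> together with \<omega> below \<open>b\<close> makes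
    \<open>b\<close> singular, hence an index of the square sequence.\<close>
  have sing: "b \<in> Sing (osucc q)" if "k \<in> K" "b \<in> S k" "Limit b" "omega \<in> elts b" for k b
    using S(1)[OF that(1)] that kq[OF that(1)] unfolding E_omega_def Sing_def by auto
  define T where "T k d = {b \<in> S k. Limit b \<and> omega \<in> elts b \<and> otp (C b) = d}" for k d
  have "\<exists>d. stationary (T k d) k" if "k \<in> K" for k
    unfolding T_def
  proof (rule pressing_down[OF regK(1,2)[OF that] S(2)[OF that]])
    show "otp (C b) \<in> elts b" if b: "b \<in> S k" "Limit b" "omega \<in> elts b" for b
      using sq sing[OF \<open>k \<in> K\<close> b] unfolding square_seq_def by blast
  qed
  then obtain \<delta> where \<delta>: "\<And>k. k \<in> K \<Longrightarrow> stationary (T k (\<delta> k)) k" by metis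
  define S' where "S' k = T k (\<delta> k)" for k
  have S'_cf: "cf b = omega" if "k \<in> K" "b \<in> S' k" for k b
    using S(1)[OF that(1)] that(2) unfolding S'_def T_def E_omega_def by blast
  have S'_otp: "otp (C b) = otp (C c)" if "b \<in> S' k" "c \<in> S' k" for k b c
    using that unfolding S'_def T_def by simp

  \<comment> \<open>Any cardinal above \<open>q\<close> puts \<open>K\<close> and all ordinals below
    its members into \<open>H c\<close>, so one \<open>c0\<close> serves every
    \<open>n\<close>.\<close>
  obtain c0 where c0: "Card c0" "q \<in> elts c0" using Card_above[OF oq] by blast

  \<comment> \<open>Fat chains for an arbitrary algebra\<close>
  have fat: "\<exists>N. fat_chain (H c) M K (\<lambda>k. elts k - S' k) n N \<and> (\<forall>a\<in>elts (osucc n). K \<subseteq> N a)"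
    if n: "regular_card n" "\<forall>k\<in>K. n \<in> elts k" and c: "Card c" "elts c0 \<subseteq> elts c"
      and M: "algebra_on (H c) M" for n c M
  proof -
    have on: "Ord n" by (rule Limit_Ord[OF regular_card_Limit[OF n(1)]])
    have o\<psi>: "Ord \<psi>" and i\<psi>: "infinite (elts \<psi>)" and l\<psi>: "Limit \<psi>"
      using assms(8) InfCard_Limit unfolding InfCard_def Card_def by auto
    have \<psi>': "csucc \<psi> \<in> elts k0"
      using Ord_trans[OF regK(4)[OF k0]] assms(9) csucc(2)[OF Card_Ord[OF csucc(1)[OF o\<psi>]]]
      unfolding k0_def by blast
    \<comment> \<open>The maximum of \<psi> and \<theta>: it is infinite, so its cardinal successor
      is regular, and that successor is below \<open>k0\<close>.\<close>
    define l where "l = (if \<theta> \<in> elts \<psi> then \<psi> else \<theta>)"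
    have ol: "Ord l" and tl: "\<theta> \<in> elts l \<or> \<theta> = l" and pl: "elts \<psi> \<subseteq> elts l" and lk: "csucc l \<in> elts k0"
      using assms(1,6) o\<psi> Ord_not_mem[OF assms(1) o\<psi>] \<psi>' unfolding l_def k0_def by auto
    \<comment> \<open>A regular length below all of \<open>K\<close> that is at least
      \<open>n\<close> and strictly above \<theta> and \<omega>. If \<open>n\<close> is already
      above \<open>l\<close>, it is kept and the chain uses its full length.\<close>
    define m where "m = (if l \<in> elts n then n else csucc l)"
    have lm: "l \<in> elts m" using csucc(2)[OF ol] unfolding m_def by auto
    have m: "regular_card m"
      using n(1) regular_csucc[OF ol infinite_super[OF pl i\<psi>]] unfolding m_def by auto
    have om: "Ord m" by (rule Limit_Ord[OF regular_card_Limit[OF m]])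
    have em: "elts (osucc m) = insert m (elts m)" by (rule elts_osucc[OF om])
    have \<theta>m: "\<theta> \<in> elts m" using tl lm Ord_trans[OF om lm] by blast
    have "Ord (omega :: 'v)" by (rule Limit_Ord[OF omega_Limit[OF l\<psi>]])
    then have wm: "omega \<in> elts m"
      using Ord_mem_subset_trans[OF _ ol _ lm om] omega_subset[OF l\<psi>] pl by blast
    have nm: "elts n \<subseteq> elts m"
    proof (cases "l \<in> elts n")
      case True
      then show ?thesis by (simp add: m_def)
    next
      case False
      show ?thesis using Ord_not_mem[OF ol on False] Ord_subset[OF om lm] by (rule order_trans)
    qed
    have "m \<in> elts k0" using n(2) k0 lk unfolding m_def by auto
    then have mk: "m \<in> elts k" if "k \<in> K" for k using minK[OF that] by blast
    have K\<theta>: "K \<lesssim> elts \<theta>" using assms(3) image_lepoll by blast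
    have Km: "K \<lesssim> elts m"
      by (rule lepoll_trans[OF K\<theta> subset_imp_lepoll[OF Ord_subset[OF om \<theta>m]]])
    have qc: "q \<in> elts c" using c0(2) c(2) by blast
    have KH: "K \<subseteq> H c"
      using Ord_in_H[OF c(1) qc] regK(4) eq by blast
    have kH: "elts k \<subseteq> H c" if "k \<in> K" for k
    proof
      fix y assume y: "y \<in> elts k"
      have "elts y \<subseteq> elts q" using Ord_subset[OF regK(4)[OF that] y] eq that by blast
      then show "y \<in> H c" using Ord_in_H[OF c(1) qc] Ord_in[OF regK(4)[OF that] y] by blast
    qed
    have neK: "K \<noteq> {}" using k0 by blast
    obtain N where N: "\<And>a. closed_under (skolem_ops (H c) M) (N a)" "\<And>a. K \<subseteq> N a" "\<And>a. m \<in> N a"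
      "\<And>a. a \<in> elts (osucc m) \<Longrightarrow> N a \<subseteq> H c"
      and sk: "\<And>a k. \<lbrakk>a \<in> elts (osucc m); k \<in> K\<rbrakk> \<Longrightarrow> osup (N a \<inter> elts k) \<in> elts k"
      and mono: "\<And>a b. b \<in> elts a \<Longrightarrow> N b \<subseteq> N a"
      and sN: "\<And>a b k. \<lbrakk>b \<in> elts a; k \<in> K\<rbrakk> \<Longrightarrow>
        osup (N b \<inter> elts k) \<in> N a \<and> osucc (osup (N b \<inter> elts k)) \<in> N a"
      and lim: "\<And>a. Limit a \<Longrightarrow> N a = (\<Union>b\<in>elts a. N b)"
      apply (rule chain_exists[OF m regK(1) mk neK Km countable_skolem_ops closed_skolem_ops[OF M] KH kH])
      apply assumption+
      subgoal premises p for N by (rule that[of N]; fact p)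
      done
    define s where "s k a = osup (N a \<inter> elts k)" for k a
    have es: "elts (s k a) = \<Union> (elts ` (N a \<inter> elts k))" if "k \<in> K" for k a
      using osup(2)[of "N a \<inter> elts k" k] Ord_in[OF regK(4)[OF that]] unfolding s_def by blast
    have os: "Ord (s k a)" if "k \<in> K" for k a
      using osup(1)[of "N a \<inter> elts k" k] Ord_in[OF regK(4)[OF that]] unfolding s_def by blast
    have ss: "s k a \<in> elts k" if "k \<in> K" "a \<in> elts (osucc m)" for k a
      using sk[OF that(2,1)] unfolding s_def .
    \<comment> \<open>Strictness comes from the successor of the earlier supremum, which is below
      \<open>k\<close> and belongs to the later model.\<close>
    have s_mono: "s k b \<in> elts (s k a)" if k: "k \<in> K" and a: "a \<in> elts (osucc m)" "b \<in> elts a" for k a b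
    proof -
      have b: "b \<in> elts (osucc m)" using a Ord_trans[OF om] unfolding em by blast
      have "osucc (s k b) \<in> elts k" using ss[OF k b] regK(3)[OF k] unfolding Limit_def by blast
      moreover have "osucc (s k b) \<in> N a" using sN[OF a(2) k] unfolding s_def by blast
      moreover have "s k b \<in> elts (osucc (s k b))" using elts_osucc[OF os[OF k]] by simp
      ultimately show ?thesis unfolding es[OF k] by blast
    qed
    have s_cont: "\<exists>b\<in>elts a. y \<in> elts (s k b)" if "k \<in> K" "Limit a" "y \<in> elts (s k a)" for k a y
      using that(3) unfolding es[OF that(1)] lim[OF that(2)] by blast
    \<comment> \<open>As \<open>m\<close> is an element of every model and is below
      \<open>k\<close>, already the stage \<theta> has supremum at least \<open>m\<close>; the top
      supremum is strictly larger.\<close>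
    have ms: "m \<in> elts (s k m)" if k: "k \<in> K" for k
    proof -
      have mm: "m \<in> elts (osucc m)" using em by blast
      have "elts m \<subseteq> elts (s k \<theta>)" unfolding es[OF k] using N(3) mk[OF k] by blast
      then show ?thesis
        using Ord_mem_subset_trans[OF om os[OF k] _ s_mono[OF k mm \<theta>m] os[OF k]] by blast
    qed
    have sg: "s k m \<in> elts (osucc q)" if "k \<in> K" for k
      using kq[OF that] ss[OF that, of m] em by blast
    obtain d where d: "\<And>a. a \<in> elts (osucc m) \<Longrightarrow> d a \<in> elts (osucc m) \<and> Limit (d a)"
      and d_mono: "\<And>a b. \<lbrakk>a \<in> elts (osucc m); b \<in> elts a\<rbrakk> \<Longrightarrow> d b \<in> elts (d a)"
      and d_cont: "\<And>a x. \<lbrakk>a \<in> elts (osucc m); Limit a; x \<in> elts (d a)\<rbrakk> \<Longrightarrow> \<exists>b\<in>elts a. x \<in> elts (d b)"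
      and d_S': "\<And>a k. \<lbrakk>a \<in> elts (osucc m); k \<in> K\<rbrakk> \<Longrightarrow> s k (d a) \<notin> S' k"
      apply (rule thin_out[OF m wm K\<theta> \<theta>m, where s = s and S' = S' and C = C and g = "osucc q",
      OF os s_mono s_cont ms sq sg S'_cf S'_otp])
      apply assumption+
      subgoal premises p for d by (rule that[of d]; fact p)
      done
    \<comment> \<open>The indices up to and including \<open>n\<close> are among those up to and
      including \<open>m\<close>, also when \<open>n = m\<close>.\<close>
    have nm': "a \<in> elts (osucc m)" if "a \<in> elts (osucc n)" for a
      using that nm Ord_subset_cases[OF on om nm] unfolding elts_osucc[OF on] em by blast
    have "fat_chain (H c) M K (\<lambda>k. elts k - S' k) n (\<lambda>a. N (d a))"
      unfolding fat_chain_def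
    proof (intro conjI ballI impI)
      fix a assume a: "a \<in> elts (osucc n)"
      note a' = nm'[OF a] and da = d[OF nm'[OF a]]
      show "elementary_sub (N (d a)) (H c) M"
        using elementary_sub_skolem[OF N(1) N(4)] da N(3) by blast
      show "N (d b) \<subseteq> N (d a)" if "b \<in> elts a" for b by (rule mono[OF d_mono[OF a' that]])
      show "N (d a) = (\<Union>b\<in>elts a. N (d b))" if La: "Limit a"
      proof
        show "(\<Union>b\<in>elts a. N (d b)) \<subseteq> N (d a)" using mono[OF d_mono[OF a']] by blast
        show "N (d a) \<subseteq> (\<Union>b\<in>elts a. N (d b))"
        proof
          fix y assume "y \<in> N (d a)"
          then obtain z where z: "z \<in> elts (d a)" "y \<in> N z" using lim[of "d a"] da by blast
          then obtain b where b: "b \<in> elts a" "z \<in> elts (d b)" using d_cont[OF a' La] by blast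
          then show "y \<in> (\<Union>b\<in>elts a. N (d b))" using mono[OF b(2)] z(2) by blast
        qed
      qed
      fix k assume k: "k \<in> N (d a) \<inter> K"
      show "osup (N (d a) \<inter> elts k) \<in> elts k - S' k"
        using ss[of k "d a"] d_S'[OF a', of k] da k unfolding s_def by blast
      show "osup (N (d a) \<inter> elts k) \<in> N (d (osucc a))" if an: "a \<in> elts n"
      proof -
        have oa: "Ord a" by (rule Ord_in[OF on an])
        \<comment> \<open>The next index stays below the limit \<open>n\<close>, and
          \<open>d\<close> sends it to a strictly later stage, which contains the supremum of the
          earlier one.\<close>
        have "osucc a \<in> elts n"
          using an regular_card_Limit[OF n(1)] unfolding Limit_def by blast
        then have "osucc a \<in> elts (osucc m)" using nm em by blast
        then have "d a \<in> elts (d (osucc a))" using d_mono elts_osucc[OF oa] by blast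
        then show ?thesis using sN k by blast
      qed
    qed
    then show ?thesis using N(2) by blast
  qed
  have "strongly_mutually_fat K (\<lambda>k. elts k - S' k)"
    unfolding strongly_mutually_fat_def strongly_mutually_nu_fat_def using fat c0(1) by blast
  moreover have "S' k \<subseteq> S k \<and> stationary (S' k) k" if "k \<in> K" for k
    using \<delta>[OF that] unfolding S'_def T_def by blast
  ultimately show ?thesis by blast
qed

end
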